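(* Let $p$ be a prime. If $G$ is a self-similar finite $p$-group of degree $p$ such that the first level stabilizer is power abelian, then $G$ is a split extension of a $p$-group of exponent $p$ by a cyclic group of order $p$ (that is, $G=N\rtimes C$ with $N$ a normal subgroup of exponent $p$ and $C$ a cyclic subgroup of order $p$).
   Context: Let $\mathcal{T}_m$ be the infinite regular one-rooted $m$-ary tree and $\mathcal{A}_m=\mathrm{Aut}(\mathcal{T}_m)\cong \mathcal{A}_m\wr S_m$, where $S_m$ is the symmetric group of degree $m$, so that each $\alpha\in\mathcal{A}_m$ is written $\alpha=(\alpha_0,\dots,\alpha_{m-1})\sigma(\alpha)$ with $\alpha_i\in\mathcal{A}_m$ and $\sigma(\alpha)\in S_m$ the action of $\alpha$ on the first level. A subgroup $G\le\mathcal{A}_m$ is state-closed if $\alpha\in G$ implies $\alpha_i\in G$ for all $i$, and transitive if it acts transitively on the first level. A group is self-similar of degree $m$ if it has a faithful representation in $\mathcal{A}_m$ whose image is state-closed and transitive. Equivalently, there exist a subgroup $H$ of $G$ of index $m$ and a homomorphism $f:H\to G$ such that the only subgroup $K\le H$ that is normal in $G$ and satisfies $f(K)\le K$ is the trivial subgroup; here $H$ corresponds to the stabilizer of a vertex of the first level. For a finite $p$-group $G$ and $m=p$, the subgroup $H$ is normal of index $p$ and is the first level stabilizer of the self-similar representation. The hypothesis of the theorem is that $G$ has such a self-similar representation (equivalently, such a pair $(H,f)$) for which the first level stabilizer $H$ is power abelian. For a finite $p$-group $X$ and $n\ge 1$ put $\Omega_n(X)=\langle g\in X \mid g^{p^n}=1\rangle$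 and $X^{p^n}=\langle g^{p^n}\mid g\in X\rangle$. The group $X$ is power abelian if for all $n\geq 1$: (1) $\Omega_n(X)=\{g\in X\mid g^{p^n}=1\}$; (2) $X^{p^n}=\{g^{p^n}\mid g\in X\}$; (3) $|X^{p^n}|=|X:\Omega_n(X)|$. *)

theory Defs
  imports "HOL-Algebra.Algebra" "HOL-Computational_Algebra.Primes"
begin

section \<open>The rooted regular m-ary tree and its automorphism group\<close>

text \<open>Vertices are the finite words over the alphabet \<open>{0, \<dots>, m - 1}\<close>; the root is the empty word
  and the children of a vertex \<open>u\<close> are the words \<open>u @ [i]\<close>.\<close>

definition tree_verts :: "nat \<Rightarrow> nat list set" where
  "tree_verts m = lists {..<m}"

definition tree_adj :: "nat list \<Rightarrow> nat list \<Rightarrow> bool" where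
  "tree_adj u v \<longleftrightarrow> (\<exists>i. v = u @ [i] \<or> u = v @ [i])"

definition tree_auts :: "nat \<Rightarrow> (nat list \<Rightarrow> nat list) set" where
  "tree_auts m = {\<alpha> \<in> Bij (tree_verts m). \<alpha> [] = [] \<and>
     (\<forall>u \<in> tree_verts m. \<forall>v \<in> tree_verts m. tree_adj (\<alpha> u) (\<alpha> v) \<longleftrightarrow> tree_adj u v)}"

text \<open>Products are those of \<^const>\<open>BijGroup\<close>, i.e. \<open>\<alpha> \<otimes> \<beta>\<close> applies \<open>\<beta>\<close> first. The opposite
  convention yields the opposite group on the same set, with the same subgroups; it is isomorphic
  to this one through inversion, so none of the notions below depends on the choice.\<close>

definition TreeAut :: "nat \<Rightarrow> (nat list \<Rightarrow> nat list) monoid" where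
  "TreeAut m = BijGroup (tree_verts m) \<lparr>carrier := tree_auts m\<rparr>"

text \<open>In \<open>\<alpha> = (\<alpha>\<^sub>0, \<dots>, \<alpha>\<^sub>m\<^sub>-\<^sub>1) \<sigma>(\<alpha>)\<close> the components are determined by
  \<open>\<alpha> (i # w) = \<sigma>(\<alpha>) i # \<alpha>\<^sub>i w\<close>; see \<open>tree_aut_decomp\<close> below.\<close>

definition level1_perm :: "(nat list \<Rightarrow> nat list) \<Rightarrow> nat \<Rightarrow> nat" where
  "level1_perm \<alpha> i = hd (\<alpha> [i])"

definition state :: "nat \<Rightarrow> (nat list \<Rightarrow> nat list) \<Rightarrow> nat \<Rightarrow> (nat list \<Rightarrow> nat list)" where
  "state m \<alpha> i = (\<lambda>w \<in> tree_verts m. tl (\<alpha> (i # w)))"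

section \<open>Self-similar representations\<close>

definition state_closed :: "nat \<Rightarrow> (nat list \<Rightarrow> nat list) set \<Rightarrow> bool" where
  "state_closed m A \<longleftrightarrow> (\<forall>\<alpha> \<in> A. \<forall>i < m. state m \<alpha> i \<in> A)"

definition level1_transitive :: "nat \<Rightarrow> (nat list \<Rightarrow> nat list) set \<Rightarrow> bool" where
  "level1_transitive m A \<longleftrightarrow> (\<forall>i < m. \<forall>j < m. \<exists>\<alpha> \<in> A. level1_perm \<alpha> i = j)"

definition self_similar_rep ::
    "('a, 'b) monoid_scheme \<Rightarrow> nat \<Rightarrow> ('a \<Rightarrow> nat list \<Rightarrow> nat list) \<Rightarrow> bool" where
  "self_similar_rep G m \<rho> \<longleftrightarrow> \<rho> \<in> mon G (TreeAut m) \<and>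
     state_closed m (\<rho> ` carrier G) \<and> level1_transitive m (\<rho> ` carrier G)"

definition first_level_stabilizer ::
    "('a, 'b) monoid_scheme \<Rightarrow> nat \<Rightarrow> ('a \<Rightarrow> nat list \<Rightarrow> nat list) \<Rightarrow> 'a set" where
  "first_level_stabilizer G m \<rho> = {g \<in> carrier G. \<forall>i < m. level1_perm (\<rho> g) i = i}"

section \<open>Finite p-groups\<close>

definition finite_p_group :: "nat \<Rightarrow> ('a, 'b) monoid_scheme \<Rightarrow> bool" where
  "finite_p_group p H \<longleftrightarrow> group H \<and> finite (carrier H) \<and> (\<exists>k. order H = p ^ k)"

definition Omega :: "nat \<Rightarrow> nat \<Rightarrow> ('a, 'b) monoid_scheme \<Rightarrow> 'a set" where
  "Omega p n H = generate H {g \<in> carrier H. g [^]\<^bsub>H\<^esub> (p ^ n) = \<one>\<^bsub>H\<^esub>}"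

definition power_subgroup :: "nat \<Rightarrow> nat \<Rightarrow> ('a, 'b) monoid_scheme \<Rightarrow> 'a set" where
  "power_subgroup p n H = generate H {g [^]\<^bsub>H\<^esub> (p ^ n) | g. g \<in> carrier H}"

definition power_abelian :: "nat \<Rightarrow> ('a, 'b) monoid_scheme \<Rightarrow> bool" where
  "power_abelian p H \<longleftrightarrow> finite_p_group p H \<and> (\<forall>n \<ge> 1.
     Omega p n H = {g \<in> carrier H. g [^]\<^bsub>H\<^esub> (p ^ n) = \<one>\<^bsub>H\<^esub>} \<and>
     power_subgroup p n H = {g [^]\<^bsub>H\<^esub> (p ^ n) | g. g \<in> carrier H} \<and>
     card (power_subgroup p n H) = card (rcosets\<^bsub>H\<^esub> Omega p n H))"

text \<open>The trivial group counts as a \<open>p\<close>-group of exponent \<open>p\<close>, as it does among elementary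
  abelian \<open>p\<close>-groups. This is needed: the cyclic group of order \<open>p\<close> is self-similar of degree \<open>p\<close>
  with trivial first level stabilizer, and it is a split extension only of the trivial group by a
  cyclic group of order \<open>p\<close>.\<close>

definition p_group_of_exponent_p :: "nat \<Rightarrow> ('a, 'b) monoid_scheme \<Rightarrow> bool" where
  "p_group_of_exponent_p p H \<longleftrightarrow>
     finite_p_group p H \<and> (\<forall>x \<in> carrier H. x [^]\<^bsub>H\<^esub> p = \<one>\<^bsub>H\<^esub>)"

definition internal_semidirect :: "('a, 'b) monoid_scheme \<Rightarrow> 'a set \<Rightarrow> 'a set \<Rightarrow> bool" where
  "internal_semidirect G N C \<longleftrightarrow> N \<lhd> G \<and> subgroup C G \<and>
     N \<inter> C = {\<one>\<^bsub>G\<^esub>} \<and> N <#>\<^bsub>G\<^esub> C = carrier G"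

section \<open>Basic facts about tree automorphisms\<close>

lemma tree_verts_simps [simp]:
  "[] \<in> tree_verts m"
  "i # w \<in> tree_verts m \<longleftrightarrow> i < m \<and> w \<in> tree_verts m"
  "u @ v \<in> tree_verts m \<longleftrightarrow> u \<in> tree_verts m \<and> v \<in> tree_verts m"
  by (auto simp: tree_verts_def)

lemma tree_auts_closed: "\<alpha> \<in> tree_auts m \<Longrightarrow> u \<in> tree_verts m \<Longrightarrow> \<alpha> u \<in> tree_verts m"
  by (auto simp: tree_auts_def Bij_def bij_betw_def)

lemma tree_auts_inj:
  "\<alpha> \<in> tree_auts m \<Longrightarrow> u \<in> tree_verts m \<Longrightarrow> v \<in> tree_verts m \<Longrightarrow> \<alpha> u = \<alpha> v \<Longrightarrow> u = v"
  by (auto simp: tree_auts_def Bij_def bij_betw_def inj_on_def)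

lemma tree_auts_child:
  assumes \<alpha>: "\<alpha> \<in> tree_auts m" and "u @ [i] \<in> tree_verts m"
  shows "\<exists>j < m. \<alpha> (u @ [i]) = \<alpha> u @ [j]"
  using assms(2)
proof (induction u arbitrary: i rule: rev_induct)
  case Nil
  have "tree_adj [] [i]" "[i] \<in> tree_verts m" using Nil by (auto simp: tree_adj_def)
  then have "tree_adj (\<alpha> []) (\<alpha> [i])"
    using \<alpha> tree_verts_simps(1) unfolding tree_auts_def by blast
  moreover have "\<alpha> [] = []" using \<alpha> by (simp add: tree_auts_def)
  ultimately obtain j where "\<alpha> [i] = [j]" by (auto simp: tree_adj_def)
  with tree_auts_closed[OF \<alpha>, of "[i]"] Nil \<open>\<alpha> [] = []\<close> show ?case by auto
next
  case (snoc k u)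
  let ?v = "u @ [k]"
  have v: "?v \<in> tree_verts m" and vi: "?v @ [i] \<in> tree_verts m" using snoc.prems by auto
  obtain j where j: "\<alpha> ?v = \<alpha> u @ [j]" using snoc.IH v by blast
  have "tree_adj ?v (?v @ [i])" by (auto simp: tree_adj_def)
  then have "tree_adj (\<alpha> ?v) (\<alpha> (?v @ [i]))"
    using \<alpha> v vi unfolding tree_auts_def by blast
  then obtain l where l: "\<alpha> (?v @ [i]) = \<alpha> ?v @ [l] \<or> \<alpha> ?v = \<alpha> (?v @ [i]) @ [l]"
    by (auto simp: tree_adj_def)
  have "\<alpha> ?v \<noteq> \<alpha> (?v @ [i]) @ [l]"
  proof
    assume "\<alpha> ?v = \<alpha> (?v @ [i]) @ [l]"
    with j have "\<alpha> (?v @ [i]) = \<alpha> u" by simp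
    then have "?v @ [i] = u" using tree_auts_inj[OF \<alpha> vi, of u] v by simp
    then show False by simp
  qed
  with l have "\<alpha> (?v @ [i]) = \<alpha> ?v @ [l]" by simp
  with tree_auts_closed[OF \<alpha> vi] show ?case by auto
qed

lemma tree_auts_length:
  assumes "\<alpha> \<in> tree_auts m" "u \<in> tree_verts m"
  shows "length (\<alpha> u) = length u"
  using assms(2)
proof (induction u rule: rev_induct)
  case Nil
  then show ?case using assms(1) by (simp add: tree_auts_def)
next
  case (snoc i u)
  then show ?case using tree_auts_child[OF assms(1) snoc.prems] by auto
qed

lemma tree_aut_decomp:
  assumes \<alpha>: "\<alpha> \<in> tree_auts m" and "i < m" "w \<in> tree_verts m"
  shows "\<alpha> (i # w) = level1_perm \<alpha> i # state m \<alpha> i w"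
proof -
  have "hd (\<alpha> (i # w)) = hd (\<alpha> [i]) \<and> \<alpha> (i # w) \<noteq> []"
    using assms(3)
  proof (induction w rule: rev_induct)
    case Nil
    then show ?case using tree_auts_length[OF \<alpha>, of "[i]"] \<open>i < m\<close> by auto
  next
    case (snoc k w)
    then show ?case using tree_auts_child[OF \<alpha>, of "i # w" k] \<open>i < m\<close> by auto
  qed
  with assms(3) show ?thesis by (auto simp: level1_perm_def state_def intro: list.expand)
qed

lemma subgroup_tree_auts: "subgroup (tree_auts m) (BijGroup (tree_verts m))"
proof (rule group.subgroupI[OF group_BijGroup])
  show "tree_auts m \<subseteq> carrier (BijGroup (tree_verts m))"
    by (auto simp: tree_auts_def BijGroup_def)
  have "(\<lambda>x\<in>tree_verts m. x) \<in> tree_auts m"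
    by (auto simp: tree_auts_def id_Bij)
  then show "tree_auts m \<noteq> {}" by blast
next
  fix \<alpha> assume \<alpha>: "\<alpha> \<in> tree_auts m"
  then have B: "\<alpha> \<in> Bij (tree_verts m)" by (simp add: tree_auts_def)
  let ?\<beta> = "\<lambda>x\<in>tree_verts m. inv_into (tree_verts m) \<alpha> x"
  have im: "\<alpha> ` tree_verts m = tree_verts m" using B by (simp add: Bij_def bij_betw_def)
  have mem: "inv_into (tree_verts m) \<alpha> x \<in> tree_verts m" if "x \<in> tree_verts m" for x
    using im that by (metis inv_into_into)
  have ap: "\<alpha> (inv_into (tree_verts m) \<alpha> x) = x" if "x \<in> tree_verts m" for x
    using im that by (metis f_inv_into_f)
  have "\<alpha> [] = []" using \<alpha> by (simp add: tree_auts_def)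
  then have "inv_into (tree_verts m) \<alpha> [] = []"
    using tree_auts_inj[OF \<alpha>, of "inv_into (tree_verts m) \<alpha> []" "[]"] mem ap by simp
  moreover have "tree_adj (?\<beta> u) (?\<beta> v) \<longleftrightarrow> tree_adj u v"
    if "u \<in> tree_verts m" "v \<in> tree_verts m" for u v
  proof -
    have "tree_adj (\<alpha> (?\<beta> u)) (\<alpha> (?\<beta> v)) \<longleftrightarrow> tree_adj (?\<beta> u) (?\<beta> v)"
      using \<alpha> mem that by (simp add: tree_auts_def)
    then show ?thesis using ap that by simp
  qed
  ultimately have "?\<beta> \<in> tree_auts m"
    using restrict_inv_into_Bij[OF B] unfolding tree_auts_def by simp
  then show "inv\<^bsub>BijGroup (tree_verts m)\<^esub> \<alpha> \<in> tree_auts m"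
    by (simp add: inv_BijGroup[OF B])
next
  fix \<alpha> \<beta> assume a: "\<alpha> \<in> tree_auts m" "\<beta> \<in> tree_auts m"
  then have "compose (tree_verts m) \<alpha> \<beta> \<in> tree_auts m"
    using tree_auts_closed[OF a(2)]
    by (simp add: tree_auts_def compose_Bij compose_eq)
  then show "\<alpha> \<otimes>\<^bsub>BijGroup (tree_verts m)\<^esub> \<beta> \<in> tree_auts m"
    using a by (simp add: BijGroup_def tree_auts_def)
qed

lemma group_TreeAut: "group (TreeAut m)"
  unfolding TreeAut_def
  using group.subgroup_imp_group[OF group_BijGroup subgroup_tree_auts] .

end

theory Submission
  imports Defs
begin

text \<open>
  Let \<open>H\<close> be the first-level stabilizer and let \<open>f\<close> map an element of \<open>H\<close> to its section at a vertex of
  the first level. Then \<open>H\<close> is normal of index \<open>p\<close>, and \<open>f\<close> is a simple virtual endomorphism: no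
  nontrivial normal subgroup of \<open>G\<close> inside \<open>H\<close> is mapped into itself by \<open>f\<close>. The theorem holds with
  \<open>N = H\<close>, so a complement of \<open>H\<close> is needed, and \<open>H\<close> must have exponent \<open>p\<close>.

  \<^bold>\<open>The complement.\<close> Let \<open>R\<^sub>0 = G\<close> and \<open>R\<^sub>j\<^sub>+\<^sub>1 = f(R\<^sub>j \<inter> H)\<close>. This chain decreases until some
  \<open>R\<^sub>r\<close> is the last term that is not contained in \<open>H\<close>. The normal closure of \<open>R\<^sub>r\<^sub>+\<^sub>1\<close>, and then that of
  \<open>R\<^sub>r \<inter> H\<close>, is \<open>f\<close>-invariant, so both are trivial, and \<open>C = R\<^sub>r\<close> is a complement of order \<open>p\<close>
  (\<open>C_Int_H\<close>, \<open>card_C\<close>).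

  \<^bold>\<open>The exponent.\<close> Let \<open>T\<close> be the set of elements of \<open>H\<close> of order dividing \<open>p\<close>, a subgroup because \<open>H\<close>
  is power abelian. Suppose that \<open>T \<noteq> H\<close>. The third condition in the definition says that the subgroup
  generated by the \<open>p\<close>-th powers of \<open>H\<close> has order exactly \<open>|H : T|\<close>. On the other hand \<open>p\<close>-th powers
  of elements of \<open>H\<close> are computed in the sections, and there are too many of them: the subgroup that
  they generate has order at least \<open>p |H : T|\<close> (\<open>many_powers\<close>).

  The count goes down the tree. For suitable subgroups \<open>L\<close> of \<open>R\<^sub>j \<inter> H\<close> one shows that the \<open>p\<close>-th powers
  of \<open>L\<close> generate a subgroup of order at least \<open>|L : L \<inter> T|\<close>, with an additional factor \<open>p\<close> if \<open>L\<close> is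
  normalized by \<open>C\<close>, is not contained in \<open>T\<close>, and \<open>L \<inter> T\<close> moves vertices of the second level (\<open>power_bound\<close>).
  One chooses a section that detects a nontrivial \<open>p\<close>-th power and splits \<open>L\<close> into the image \<open>F\<close> of this section, a subgroup
  of \<open>R\<^sub>j\<^sub>+\<^sub>1\<close>, and the part of \<open>L\<close> whose section lies in \<open>T\<close>. The only obstacle is an image \<open>F\<close> that is
  not contained in \<open>H\<close> while \<open>F \<inter> H\<close> is not contained in \<open>T\<close>: its order is \<open>p\<close> times that of \<open>F \<inter> H\<close>, to which the induction applies. The
  missing factor is precisely the additional factor for \<open>F \<inter> H\<close>, and it is available because
  \<open>F \<inter> T\<close> moves vertices of the second level (\<open>torsion_moves_level\<close>). The latter is a commutator
  argument, which rests on the facts that \<open>C\<close> centralizes \<open>f(H)\<close> modulo \<open>T\<close> (\<open>commutator_torsion\<close>)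
  and that each element of \<open>C\<close> occurs as the constant section of an element of \<open>T\<close>
  (\<open>constant_sections\<close>).
\<close>


section \<open>Finite groups of prime power order\<close>

lemma (in group) card_subgroup_dvd:
  assumes "subgroup A G" "subgroup B G" "A \<subseteq> B"
  shows "card A dvd card B"
proof -
  interpret B: group "G\<lparr>carrier := B\<rparr>"
    using assms(2) by (rule subgroup_imp_group)
  have "subgroup A (G\<lparr>carrier := B\<rparr>)"
    using assms by (rule subgroup_incl)
  from B.lagrange[OF this] have "card B = card (rcosets\<^bsub>G\<lparr>carrier := B\<rparr>\<^esub> A) * card A"
    by (simp add: order_def)
  then show ?thesis
    by (rule dvdI[OF trans[OF _ mult.commute]])
qed

lemma (in group) prime_power_index:
  assumes "Factorial_Ring.prime p" "finite (carrier G)" "order G = p ^ n"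
    and A: "subgroup A G" and B: "subgroup B G" and "A \<subset> B"
  shows "p * card A \<le> card B"
proof -
  have finB: "finite B"
    using subgroup.subset[OF B] assms(2) by (rule finite_subset)
  obtain d where d: "card B = card A * d"
    using card_subgroup_dvd[OF A B] \<open>A \<subset> B\<close> by (auto elim: dvdE)
  have "card B dvd order G"
    using card_subgroup_dvd[OF B subgroup_self] subgroup.subset[OF B] by (simp add: order_def)
  then have "d dvd p ^ n"
    using d assms(3) by (metis dvd_mult_right)
  then obtain i where i: "d = p ^ i"
    using divides_primepow_nat[OF assms(1)] by auto
  have "card A < card B"
    using finB \<open>A \<subset> B\<close> by (rule psubset_card_mono)
  then have "i \<noteq> 0"
    using d i by (metis less_irrefl mult.right_neutral power_0)
  then have "p \<le> d"
    using i prime_ge_1_nat[OF assms(1)] by (metis self_le_power gr0I)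
  then show ?thesis
    using d by (metis mult.commute mult_le_mono2)
qed

text \<open>Orbits have prime power length, so the points that are not fixed fall into orbits of length
  divisible by \<open>p\<close>.\<close>

lemma (in group_action) prime_power_dvd_card_fixed_points:
  assumes p: "Factorial_Ring.prime p" and "order G = p ^ n" and "finite E" "p dvd card E"
  shows "p dvd card {x \<in> E. \<forall>g \<in> carrier G. \<phi> g x = x}" (is "p dvd card ?F")
proof -
  interpret G: group G
    using group_hom by (rule group_hom.axioms(1))
  let ?C = "orbit G \<phi> ` (E - ?F)"
  have self: "x \<in> orbit G \<phi> x" if "x \<in> E" for x
    using orbit_refl[OF that] .
  have sub: "orbit G \<phi> x \<subseteq> E - ?F" if x: "x \<in> E - ?F" for x
  proof
    fix y assume y: "y \<in> orbit G \<phi> x"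
    have xE: "x \<in> E" using x by simp
    have yE: "y \<in> E"
      using y xE element_image unfolding orbit_def by blast
    moreover have "y \<notin> ?F"
    proof
      assume "y \<in> ?F"
      then have fixed: "\<forall>g \<in> carrier G. \<phi> g y = y" by simp
      have "x \<in> orbit G \<phi> y"
        using orbit_sym[OF xE yE y] .
      then have "x = y"
        using fixed unfolding orbit_def by auto
      with fixed x show False by auto
    qed
    ultimately show "y \<in> E - ?F" by simp
  qed
  have un: "\<Union>?C = E - ?F"
    using sub self by blast
  have "p dvd card (\<Union>?C)"
  proof (rule dvd_partition)
    show "finite (\<Union>?C)" using un assms(3) by simp
    show "\<forall>c \<in> ?C. p dvd card c"
    proof
      fix c assume "c \<in> ?C"
      then obtain x where x: "x \<in> E - ?F" and c: "c = orbit G \<phi> x" by auto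
      have "card c * card (stabilizer G \<phi> x) = p ^ n"
        using orbit_stabilizer_theorem[of x] x c assms(2) by simp
      then have "card c dvd p ^ n"
        by (rule dvdI[OF sym])
      then obtain i where i: "card c = p ^ i"
        using divides_primepow_nat[OF p] by auto
      have "i \<noteq> 0"
      proof
        assume "i = 0"
        then have "card c = 1" using i by simp
        then obtain y where "c = {y}" by (rule card_1_singletonE)
        then have "c = {x}" using self[of x] x c by auto
        then have "\<forall>g \<in> carrier G. \<phi> g x = x" using c unfolding orbit_def by blast
        then show False using x by simp
      qed
      then show "p dvd card c" using i by simp
    qed
    show "\<forall>c1 \<in> ?C. \<forall>c2 \<in> ?C. c1 \<noteq> c2 \<longrightarrow> c1 \<inter> c2 = {}"
    proof (intro ballI impI)
      fix c1 c2 assume "c1 \<in> ?C" "c2 \<in> ?C" and ne: "c1 \<noteq> c2"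
      then obtain x y where x: "x \<in> E" "c1 = orbit G \<phi> x" and y: "y \<in> E" "c2 = orbit G \<phi> y"
        by auto
      have unique: "\<exists>!b. b \<in> orbits G E \<phi> \<and> z \<in> b" if "z \<in> E" for z
        using partition.unique_class[OF orbit_partition that] .
      have "c1 \<in> orbits G E \<phi>" "c2 \<in> orbits G E \<phi>"
        using x y unfolding orbits_def by auto
      moreover have "c1 \<subseteq> E"
        using x element_image unfolding orbit_def by blast
      ultimately show "c1 \<inter> c2 = {}"
        using unique ne by blast
    qed
  qed
  then have "p dvd card E - card ?F"
    using un assms(3) by (simp add: card_Diff_subset)
  then show ?thesis
    using assms(4) card_mono[OF assms(3), of ?F] by (rule dvd_diffD1) blast
qed

lemma card_hom_preimage:
  fixes G :: "('a, 'b) monoid_scheme" and K :: "('c, 'd) monoid_scheme"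
  assumes "group_hom G K \<phi>" "finite (carrier G)" "B \<subseteq> \<phi> ` carrier G"
  shows "card {x \<in> carrier G. \<phi> x \<in> B} = card B * card {x \<in> carrier G. \<phi> x = \<one>\<^bsub>K\<^esub>}"
proof -
  interpret group_hom G K \<phi> by fact
  have finB: "finite B"
    using assms(3) finite_imageI[OF assms(2)] by (rule finite_subset)
  have fib: "card {x \<in> carrier G. \<phi> x = b} = card {x \<in> carrier G. \<phi> x = \<one>\<^bsub>K\<^esub>}" if b: "b \<in> B" for b
  proof -
    obtain y where y: "y \<in> carrier G" "\<phi> y = b" using assms(3) b by blast
    have "bij_betw (\<lambda>x. y \<otimes>\<^bsub>G\<^esub> x) {x \<in> carrier G. \<phi> x = \<one>\<^bsub>K\<^esub>} {x \<in> carrier G. \<phi> x = b}"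
    proof (rule bij_betw_byWitness[where f' = "\<lambda>x. inv\<^bsub>G\<^esub> y \<otimes>\<^bsub>G\<^esub> x"])
      show "\<forall>x \<in> {x \<in> carrier G. \<phi> x = \<one>\<^bsub>K\<^esub>}. inv\<^bsub>G\<^esub> y \<otimes>\<^bsub>G\<^esub> (y \<otimes>\<^bsub>G\<^esub> x) = x"
        using y by (simp add: G.m_assoc[symmetric])
      show "\<forall>x \<in> {x \<in> carrier G. \<phi> x = b}. y \<otimes>\<^bsub>G\<^esub> (inv\<^bsub>G\<^esub> y \<otimes>\<^bsub>G\<^esub> x) = x"
        using y by (simp add: G.m_assoc[symmetric])
    qed (use y in auto)
    then show ?thesis by (rule bij_betw_same_card[symmetric])
  qed
  have "{x \<in> carrier G. \<phi> x \<in> B} = (\<Union>b \<in> B. {x \<in> carrier G. \<phi> x = b})" by auto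
  also have "card \<dots> = (\<Sum>b \<in> B. card {x \<in> carrier G. \<phi> x = b})"
    by (rule card_UN_disjoint) (use finB assms(2) in auto)
  also have "\<dots> = card B * card {x \<in> carrier G. \<phi> x = \<one>\<^bsub>K\<^esub>}"
    using fib by simp
  finally show ?thesis .
qed


section \<open>Conjugation\<close>

context group
begin

abbreviation conjugate :: "'a \<Rightarrow> 'a \<Rightarrow> 'a" where
  "conjugate a x \<equiv> a \<otimes> x \<otimes> inv a"

lemma conj_mult:
  "a \<in> carrier G \<Longrightarrow> x \<in> carrier G \<Longrightarrow> y \<in> carrier G \<Longrightarrow> conjugate a (x \<otimes> y) = conjugate a x \<otimes> conjugate a y"
  by (simp add: m_assoc inv_solve_left)

lemma conj_conj:
  "a \<in> carrier G \<Longrightarrow> b \<in> carrier G \<Longrightarrow> x \<in> carrier G \<Longrightarrow> conjugate a (conjugate b x) = conjugate (a \<otimes> b) x"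
  by (simp add: m_assoc inv_mult_group)

lemma conj_inv:
  "a \<in> carrier G \<Longrightarrow> x \<in> carrier G \<Longrightarrow> conjugate a (inv x) = inv (conjugate a x)"
  by (simp add: m_assoc inv_mult_group)

lemma conj_pow:
  "a \<in> carrier G \<Longrightarrow> x \<in> carrier G \<Longrightarrow> conjugate a (x [^] (n::nat)) = conjugate a x [^] n"
  by (induction n) (simp_all add: conj_mult)

lemma inv_conj_cancel:
  "a \<in> carrier G \<Longrightarrow> x \<in> carrier G \<Longrightarrow> conjugate (inv a) (conjugate a x) = x"
  "a \<in> carrier G \<Longrightarrow> x \<in> carrier G \<Longrightarrow> conjugate a (conjugate (inv a) x) = x"
  using conj_conj[of "inv a" a x] conj_conj[of a "inv a" x] by simp_all

lemma inv_mult_cancel: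
  "x \<in> carrier G \<Longrightarrow> y \<in> carrier G \<Longrightarrow> inv x \<otimes> (x \<otimes> y) = y"
  "x \<in> carrier G \<Longrightarrow> y \<in> carrier G \<Longrightarrow> x \<otimes> (inv x \<otimes> y) = y"
  by (simp_all add: m_assoc[symmetric])

lemma subgroup_conj_closed:
  "subgroup A G \<Longrightarrow> a \<in> A \<Longrightarrow> x \<in> A \<Longrightarrow> conjugate a x \<in> A"
  by (simp add: subgroup.m_closed subgroup.m_inv_closed)

lemma subgroup_pow_closed:
  "subgroup A G \<Longrightarrow> x \<in> A \<Longrightarrow> x [^] (n::nat) \<in> A"
  by (induction n) (simp_all add: subgroup.m_closed subgroup.one_closed)

end

section \<open>Simple virtual endomorphisms\<close>

text \<open>A homomorphism \<open>f\<close> from a subgroup \<open>H\<close> of index \<open>p\<close> to \<open>G\<close> is simple if \<open>H\<close> contains no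
  nontrivial normal subgroup of \<open>G\<close> that \<open>f\<close> maps into itself; on the tree this says that the action
  is faithful. The map \<open>f\<close> is the section at a fixed vertex \<open>v\<close> of the first level.\<close>

locale simple_virtual_endomorphism = group G for G (structure) +
  fixes p n :: nat and H and f
  assumes prime_p: "Factorial_Ring.prime p"
    and finite_G: "finite (carrier G)"
    and order_G: "order G = p ^ n"
    and normal_H: "H \<lhd> G"
    and index_H: "card (carrier G) = p * card H"
    and f_closed: "h \<in> H \<Longrightarrow> f h \<in> carrier G"
    and f_mult: "h \<in> H \<Longrightarrow> k \<in> H \<Longrightarrow> f (h \<otimes> k) = f h \<otimes> f k"
    and simple: "K \<lhd> G \<Longrightarrow> K \<subseteq> H \<Longrightarrow> f ` K \<subseteq> K \<Longrightarrow> K = {\<one>}"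
begin

lemma subgroup_H: "subgroup H G"
  using normal_H by (rule normal_imp_subgroup)

sublocale H: subgroup H G
  by (rule subgroup_H)

lemma conj_H: "a \<in> carrier G \<Longrightarrow> h \<in> H \<Longrightarrow> conjugate a h \<in> H"
  using normal.inv_op_closed2[OF normal_H] .

text \<open>The section of \<open>h\<close> at the vertex \<open>inv a (v)\<close>, up to the choice of coordinates on the subtrees.\<close>

definition sec :: "'a \<Rightarrow> 'a \<Rightarrow> 'a" where
  "sec a h = f (conjugate a h)"

lemma sec_closed: "a \<in> carrier G \<Longrightarrow> h \<in> H \<Longrightarrow> sec a h \<in> carrier G"
  by (simp add: sec_def conj_H f_closed)

lemma sec_mult:
  "a \<in> carrier G \<Longrightarrow> h \<in> H \<Longrightarrow> k \<in> H \<Longrightarrow> sec a (h \<otimes> k) = sec a h \<otimes> sec a k"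
  by (simp add: sec_def conj_mult conj_H f_mult)

lemma group_hom_sec: 
  assumes "a \<in> carrier G" "subgroup L G" "L \<subseteq> H"
  shows "group_hom (G\<lparr>carrier := L\<rparr>) G (sec a)"
proof (rule group_hom.intro[OF subgroup_imp_group[OF assms(2)] is_group group_hom_axioms.intro])
  show "sec a \<in> hom (G\<lparr>carrier := L\<rparr>) G"
    using assms(1,3) by (auto simp: hom_def sec_closed sec_mult subset_iff)
qed

lemma sec_one_index: "h \<in> H \<Longrightarrow> sec \<one> h = f h"
  by (simp add: sec_def)

lemma sec_one: "a \<in> carrier G \<Longrightarrow> sec a \<one> = \<one>"
  using group_hom.hom_one[OF group_hom_sec[OF _ subgroup_H]] by simp

lemma sec_inv: "a \<in> carrier G \<Longrightarrow> h \<in> H \<Longrightarrow> sec a (inv h) = inv (sec a h)"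
  using group_hom.hom_inv[OF group_hom_sec[OF _ subgroup_H], of a h]
  by (simp add: m_inv_consistent[OF subgroup_H])

lemma sec_pow: "a \<in> carrier G \<Longrightarrow> h \<in> H \<Longrightarrow> sec a (h [^] (k::nat)) = sec a h [^] k"
  by (induction k) (simp_all add: sec_one sec_mult subgroup_pow_closed[OF subgroup_H])

lemma sec_conj:
  assumes "a \<in> carrier G" "h \<in> H" "k \<in> H"
  shows "sec a (conjugate k h) = conjugate (sec a k) (sec a h)"
  using assms by (simp add: sec_mult sec_inv)

lemma f_one: "f \<one> = \<one>"
  using sec_one[of \<one>] by (simp add: sec_def)

lemma sec_image_subgroup:
  assumes "a \<in> carrier G" "subgroup L G" "L \<subseteq> H"
  shows "subgroup (sec a ` L) G"
proof -
  interpret L: group "G\<lparr>carrier := L\<rparr>"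
    using assms(2) by (rule subgroup_imp_group)
  show ?thesis
    using group_hom.subgroup_img_is_subgroup[OF group_hom_sec[OF assms] L.subgroup_self] by simp
qed

text \<open>A subgroup that properly contains a subgroup of prime index is the whole group; this applies to
  the product of \<open>H\<close> and \<open>B\<close>.\<close>

lemma mult_transversal:
  assumes B: "subgroup B G" "\<not> B \<subseteq> H" and g: "g \<in> carrier G"
  obtains h b where "h \<in> H" "b \<in> B" "g = h \<otimes> b"
proof -
  have sub: "subgroup (H <#> B) G"
    using mult_norm_subgroup[OF normal_H B(1)] .
  have H_le: "H \<subseteq> H <#> B"
  proof
    fix h assume "h \<in> H"
    then have "h = h \<otimes> \<one>" by simp
    then show "h \<in> H <#> B"
      using \<open>h \<in> H\<close> subgroup.one_closed[OF B(1)] unfolding set_mult_def by blast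
  qed
  have B_le: "B \<subseteq> H <#> B"
  proof
    fix b assume "b \<in> B"
    then have "b = \<one> \<otimes> b" using subgroup.mem_carrier[OF B(1)] by simp
    then show "b \<in> H <#> B"
      using \<open>b \<in> B\<close> H.one_closed unfolding set_mult_def by blast
  qed
  have "p * card H \<le> card (H <#> B)"
    using prime_power_index[OF prime_p finite_G order_G subgroup_H sub] H_le B_le B(2) by blast
  then have "H <#> B = carrier G"
    using index_H card_seteq[OF finite_G subgroup.subset[OF sub]] by simp
  with g show thesis
    using that unfolding set_mult_def by auto
qed

text \<open>This is how simplicity is used throughout. Every \<open>g\<close> in \<open>G\<close> is a product of some \<open>h\<close> in \<open>H\<close> and
  some \<open>b\<close> in \<open>B\<close>, so \<open>f\<close> maps the conjugate of \<open>x\<close> by \<open>g\<close> to the conjugate of \<open>sec b x\<close> by \<open>f h\<close>.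
  Hence the normal closure of \<open>A\<close> is invariant under \<open>f\<close>, and it is trivial.\<close>

lemma trivial_if_invariant:
  assumes A: "A \<subseteq> H" and B: "subgroup B G" "\<not> B \<subseteq> H"
    and inv: "\<And>b x. b \<in> B \<Longrightarrow> x \<in> A \<Longrightarrow> sec b x \<in> A"
  shows "A \<subseteq> {\<one>}"
proof -
  let ?S = "{conjugate g x | g x. g \<in> carrier G \<and> x \<in> A}"
  have AG: "A \<subseteq> carrier G"
    using A H.subset by blast
  have S_H: "?S \<subseteq> H"
    using A conj_H by blast
  have S_G: "?S \<subseteq> carrier G"
    using S_H H.subset by blast
  have normal: "generate G ?S \<lhd> G"
  proof (rule normal_generateI[OF S_G])
    fix y g assume "y \<in> ?S" and g: "g \<in> carrier G"
    then obtain k x where k: "k \<in> carrier G" "x \<in> A" "y = conjugate k x" by blast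
    then have "conjugate g y = conjugate (g \<otimes> k) x"
      using g AG by (simp only: conj_conj subset_iff)
    then show "conjugate g y \<in> ?S"
      using g k by blast
  qed
  have gen_H: "generate G ?S \<subseteq> H"
    using generate_subgroup_incl[OF S_H subgroup_H] .
  have f_S: "f y \<in> ?S" if "y \<in> ?S" for y
  proof -
    obtain g x where g: "g \<in> carrier G" "x \<in> A" "y = conjugate g x" using \<open>y \<in> ?S\<close> by blast
    obtain h b where hb: "h \<in> H" "b \<in> B" "g = h \<otimes> b"
      using mult_transversal[OF B g(1)] .
    have mem: "x \<in> carrier G" "x \<in> H" "b \<in> carrier G" "h \<in> carrier G"
      using g hb A AG subgroup.mem_carrier[OF B(1)] H.mem_carrier by blast+
    have "y = conjugate h (conjugate b x)"
      using g hb mem by (simp only: conj_conj)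
    then have "f y = conjugate (f h) (sec b x)"
      using sec_conj[of \<one> "conjugate b x" h] hb(1) conj_H[OF mem(3,2)] H.mem_carrier
      by (simp add: sec_def)
    then show "f y \<in> ?S"
      using inv[OF hb(2) g(2)] f_closed[OF hb(1)] by blast
  qed
  have "f y \<in> generate G ?S" if "y \<in> generate G ?S" for y
    using that
  proof (induction rule: generate.induct)
    case one
    then show ?case by (simp add: f_one generate.one)
  next
    case (incl y)
    then show ?case by (intro generate.incl f_S)
  next
    case (inv y)
    then have "y \<in> H" using S_H by blast
    then have "f (inv y) = inv (f y)"
      using sec_inv[of \<one> y] by (simp add: sec_one_index)
    then show ?case
      using generate.inv[OF f_S[OF inv], of G] by simp
  next
    case (eng y z)
    then have "y \<in> H" "z \<in> H" using gen_H by blast+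
    then show ?case
      using eng by (simp add: f_mult generate.eng)
  qed
  then have "generate G ?S = {\<one>}"
    using simple[OF normal gen_H] by blast
  moreover have "A \<subseteq> generate G ?S"
  proof
    fix x assume x: "x \<in> A"
    then have "x = conjugate \<one> x" using AG by auto
    then have "x \<in> ?S" using x one_closed by blast
    then show "x \<in> generate G ?S" by (rule generate.incl)
  qed
  ultimately show ?thesis by blast
qed

end


section \<open>Iterated images and the complement\<close>

context simple_virtual_endomorphism
begin

text \<open>The image of the partial map \<open>f\<^sup>j\<close> on the largest subgroup where it is defined. The chain is
  decreasing, and it must drop into \<open>H\<close>: as long as a term is not contained in \<open>H\<close>, the next one is
  smaller.\<close>

primrec image_chain :: "nat \<Rightarrow> 'a set" where
  "image_chain 0 = carrier G"
| "image_chain (Suc j) = f ` (image_chain j \<inter> H)"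

lemma subgroup_image_chain: "subgroup (image_chain j) G"
proof (induction j)
  case 0
  show ?case by (simp add: subgroup_self)
next
  case (Suc j)
  then have sub: "subgroup (image_chain j \<inter> H) G"
    using subgroup_H by (rule subgroups_Inter_pair)
  have "f ` (image_chain j \<inter> H) = sec \<one> ` (image_chain j \<inter> H)"
    by (auto simp: sec_one_index)
  then show ?case
    using sec_image_subgroup[OF one_closed sub] by simp
qed

lemma image_chain_Suc_le: "image_chain (Suc j) \<subseteq> image_chain j"
proof (induction j)
  case 0
  show ?case using f_closed by auto
next
  case (Suc j)
  then show ?case by auto
qed

lemma image_chain_antimono: "i \<le> j \<Longrightarrow> image_chain j \<subseteq> image_chain i"
  using image_chain_Suc_le by (rule lift_Suc_antimono_le)

lemma finite_image_chain: "finite (image_chain j)"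
  using subgroup.subset[OF subgroup_image_chain] finite_G by (rule finite_subset)

lemma finite_H: "finite H"
  using H.subset finite_G by (rule finite_subset)

lemma card_H_pos: "card H > 0"
  unfolding card_gt_0_iff using finite_H H.one_closed by blast

lemma card_H_less: "card H < card (carrier G)"
  using card_H_pos index_H prime_gt_1_nat[OF prime_p] by simp

lemma image_chain_reaches_H: "\<exists>j. image_chain (Suc j) \<subseteq> H"
proof (rule ccontr)
  assume "\<not> ?thesis"
  then have not_sub: "\<not> image_chain (Suc j) \<subseteq> H" for j by blast
  have not_sub': "\<not> image_chain j \<subseteq> H" for j
    using not_sub[of j] image_chain_Suc_le[of j] by blast
  have "card (image_chain j) + j \<le> card (carrier G)" for j
  proof (induction j)
    case 0
    show ?case by simp
  next
    case (Suc j)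
    have "card (image_chain (Suc j)) \<le> card (image_chain j \<inter> H)"
      using card_image_le[of "image_chain j \<inter> H" f] finite_image_chain by simp
    also have "\<dots> < card (image_chain j)"
      using not_sub'[of j] by (intro psubset_card_mono finite_image_chain) blast
    finally show ?case using Suc by simp
  qed
  from this[of "Suc (card (carrier G))"] show False by simp
qed

definition height :: nat where
  "height = (LEAST j. image_chain (Suc j) \<subseteq> H)"

text \<open>The last term of the chain that is not contained in \<open>H\<close>. Simplicity forces it to meet \<open>H\<close>
  trivially, so it is a complement of \<open>H\<close>.\<close>

definition C :: "'a set" where
  "C = image_chain height"

lemma image_chain_Suc_height: "image_chain (Suc height) \<subseteq> H"
  unfolding height_def using image_chain_reaches_H by (rule LeastI_ex)

lemma C_not_le_H: "\<not> C \<subseteq> H"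
proof (cases height)
  case 0
  show ?thesis
  proof
    assume "C \<subseteq> H"
    then have "carrier G \<subseteq> H" using 0 by (simp add: C_def)
    then have "H = carrier G" using H.subset by blast
    then show False using card_H_less by simp
  qed
next
  case (Suc j)
  then have "\<not> image_chain (Suc j) \<subseteq> H"
    unfolding height_def by (intro not_less_Least) simp
  then show ?thesis using Suc by (simp add: C_def)
qed

lemma subgroup_C: "subgroup C G"
  unfolding C_def by (rule subgroup_image_chain)

sublocale C: subgroup C G
  by (rule subgroup_C)

lemma C_le_image_chain: "j \<le> height \<Longrightarrow> C \<subseteq> image_chain j"
  unfolding C_def by (rule image_chain_antimono)

text \<open>Conjugation by \<open>C\<close> maps the next term into the intersection of \<open>C\<close> with \<open>H\<close>, whose image
  under \<open>f\<close> is this term again; so the criterion for triviality applies.\<close>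

lemma image_chain_Suc_height_trivial: "image_chain (Suc height) \<subseteq> {\<one>}"
proof (rule trivial_if_invariant[OF image_chain_Suc_height subgroup_C C_not_le_H])
  fix b x assume b: "b \<in> C" and x: "x \<in> image_chain (Suc height)"
  have "x \<in> C" "x \<in> H"
    using x image_chain_Suc_le image_chain_Suc_height unfolding C_def by blast+
  then have "conjugate b x \<in> image_chain height \<inter> H"
    using subgroup_conj_closed[OF subgroup_C b] conj_H[OF C.mem_carrier[OF b]] by (simp add: C_def)
  then show "sec b x \<in> image_chain (Suc height)"
    by (simp add: sec_def)
qed

text \<open>The intersection is normalized by \<open>C\<close>, and \<open>f\<close> maps it into the next term of the chain, which
  is trivial.\<close>

lemma C_Int_H: "C \<inter> H = {\<one>}"
proof -
  have "C \<inter> H \<subseteq> {\<one>}"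
  proof (rule trivial_if_invariant[OF _ subgroup_C C_not_le_H])
    show "C \<inter> H \<subseteq> H" by blast
    fix b x assume b: "b \<in> C" and x: "x \<in> C \<inter> H"
    then have "conjugate b x \<in> image_chain height \<inter> H"
      using subgroup_conj_closed[OF subgroup_C b] conj_H[OF C.mem_carrier[OF b]] by (simp add: C_def)
    then have "sec b x \<in> image_chain (Suc height)"
      by (simp add: sec_def)
    then have "sec b x = \<one>" using image_chain_Suc_height_trivial by blast
    then show "sec b x \<in> C \<inter> H" by simp
  qed
  then show ?thesis using C.one_closed H.one_closed by blast
qed

text \<open>Since \<open>C\<close> is a complement of \<open>H\<close>, it permutes the first level regularly, so the sections indexed
  by \<open>C\<close> are all the first-level sections, and together they determine the action on the tree.\<close>

lemma sec_faithful:
  assumes "h \<in> H" "\<And>a. a \<in> C \<Longrightarrow> sec a h = \<one>"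
  shows "h = \<one>"
proof -
  let ?K = "{h \<in> H. \<forall>a \<in> C. sec a h = \<one>}"
  have "?K \<subseteq> {\<one>}"
  proof (rule trivial_if_invariant[OF _ subgroup_C C_not_le_H])
    show "?K \<subseteq> H" by blast
    fix b x assume "b \<in> C" "x \<in> ?K"
    then have "sec b x = \<one>" by blast
    then show "sec b x \<in> ?K" using sec_one C.mem_carrier H.one_closed by simp
  qed
  moreover have "h \<in> ?K" using assms by simp
  ultimately show ?thesis by blast
qed

lemma H_mult_C: 
  assumes "g \<in> carrier G"
  obtains h b where "h \<in> H" "b \<in> C" "g = h \<otimes> b"
  using mult_transversal[OF subgroup_C C_not_le_H assms] .

lemma H_mult_C_unique:
  assumes "h \<in> H" "k \<in> H" "b \<in> C" "c \<in> C" "h \<otimes> b = k \<otimes> c"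
  shows "h = k" "b = c"
proof -
  have mem: "h \<in> carrier G" "k \<in> carrier G" "b \<in> carrier G" "c \<in> carrier G"
    using assms by auto
  have "inv k \<otimes> h = inv k \<otimes> (h \<otimes> b) \<otimes> inv b"
    using mem by (simp add: m_assoc)
  also have "\<dots> = inv k \<otimes> (k \<otimes> c) \<otimes> inv b"
    using assms(5) by simp
  also have "\<dots> = c \<otimes> inv b"
    using mem by (simp add: m_assoc[symmetric])
  finally have eq: "inv k \<otimes> h = c \<otimes> inv b" .
  have "inv k \<otimes> h \<in> H" "c \<otimes> inv b \<in> C"
    using assms by simp_all
  then have "inv k \<otimes> h \<in> C \<inter> H"
    using eq by (metis IntI)
  then have "inv k \<otimes> h = \<one>"
    unfolding C_Int_H by blast
  note unit = this
  have "inv k \<otimes> h = inv k \<otimes> k"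
    using mem by (simp only: unit l_inv)
  then show "h = k"
    by (rule l_cancel) (use mem in simp_all)
  with assms(5) have "k \<otimes> b = k \<otimes> c" by simp
  then show "b = c"
    by (rule l_cancel) (use mem in simp_all)
qed

lemma card_C: "card C = p"
proof -
  have "bij_betw (\<lambda>(h, b). h \<otimes> b) (H \<times> C) (carrier G)"
  proof (rule bij_betw_imageI)
    show "inj_on (\<lambda>(h, b). h \<otimes> b) (H \<times> C)"
    proof (rule inj_onI, clarify)
      fix h b k c assume "h \<in> H" "b \<in> C" "k \<in> H" "c \<in> C" "h \<otimes> b = k \<otimes> c"
      then show "h = k \<and> b = c" using H_mult_C_unique[of h k b c] by simp
    qed
    show "(\<lambda>(h, b). h \<otimes> b) ` (H \<times> C) = carrier G"
    proof
      show "carrier G \<subseteq> (\<lambda>(h, b). h \<otimes> b) ` (H \<times> C)"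
      proof
        fix g assume "g \<in> carrier G"
        then obtain h b where "h \<in> H" "b \<in> C" "g = h \<otimes> b" by (rule H_mult_C)
        then show "g \<in> (\<lambda>(h, b). h \<otimes> b) ` (H \<times> C)" by (intro image_eqI[of _ _ "(h, b)"]) auto
      qed
    qed auto
  qed
  then have "card (H \<times> C) = card (carrier G)" by (rule bij_betw_same_card)
  then have "card H * card C = card H * p"
    using index_H by (simp add: card_cartesian_product mult.commute)
  then show ?thesis using card_H_pos by simp
qed

lemma subgroup_of_C:
  assumes "subgroup A G" "A \<subseteq> C" "x \<in> A" "x \<noteq> \<one>"
  shows "A = C"
proof -
  have "{\<one>} \<subset> A"
    using assms subgroup.one_closed[OF assms(1)] by blast
  then have "p * card {\<one>} \<le> card A"
    by (rule prime_power_index[OF prime_p finite_G order_G triv_subgroup assms(1)])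
  then show ?thesis
    using card_seteq[OF finite_subset[OF C.subset finite_G] assms(2)] card_C by simp
qed

lemma cyclic_C: "cyclic_group (G\<lparr>carrier := C\<rparr>)"
proof -
  interpret CG: group "G\<lparr>carrier := C\<rparr>"
    using subgroup_C by (rule subgroup_imp_group)
  obtain x where x: "x \<in> C" "x \<noteq> \<one>"
    using C_not_le_H H.one_closed by blast
  have xG: "x \<in> carrier G" using x by simp
  have "generate G {x} = C"
  proof (rule subgroup_of_C[of _ x])
    show "subgroup (generate G {x}) G" using xG by (intro generate_is_subgroup) simp
    show "generate G {x} \<subseteq> C" using x(1) by (intro generate_subgroup_incl subgroup_C) simp
    show "x \<in> generate G {x}" by (rule generate.incl) simp
  qed (rule x(2))
  then have "C = range (\<lambda>k::int. x [^] k)"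
    unfolding generate_pow[OF xG] by blast
  also have "\<dots> = range (\<lambda>k::int. x [^]\<^bsub>G\<lparr>carrier := C\<rparr>\<^esub> k)"
    using int_pow_consistent[OF subgroup_C x(1)] by simp
  finally show ?thesis
    unfolding CG.cyclic_group using x(1) by auto
qed

lemma C_commute: "a \<in> C \<Longrightarrow> b \<in> C \<Longrightarrow> a \<otimes> b = b \<otimes> a"
  using comm_group.axioms(1)[OF group.cyclic_imp_abelian_group[OF subgroup_imp_group[OF subgroup_C] cyclic_C]]
    comm_monoid.m_comm by fastforce

lemma C_pow_p: "a \<in> C \<Longrightarrow> a [^] p = \<one>"
  using group.pow_order_eq_1[OF subgroup_imp_group[OF subgroup_C], of a] card_C
  by (simp add: order_def nat_pow_consistent[of _ _ C])

text \<open>The projection of \<open>G\<close> onto the complement \<open>C\<close> with kernel \<open>H\<close>.\<close>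

definition label :: "'a \<Rightarrow> 'a" where
  "label g = (THE b. b \<in> C \<and> g \<otimes> inv b \<in> H)"

lemma label_eqI: 
  assumes "g = h \<otimes> b" "h \<in> H" "b \<in> C"
  shows "label g = b"
  unfolding label_def
proof (rule the_equality)
  show "b \<in> C \<and> g \<otimes> inv b \<in> H"
    using assms by (simp add: m_assoc)
next
  fix c assume c: "c \<in> C \<and> g \<otimes> inv c \<in> H"
  have "g \<otimes> inv c \<otimes> c = h \<otimes> b"
    using assms c by (simp add: m_assoc)
  then show "c = b"
    using c assms H_mult_C_unique(2)[of "g \<otimes> inv c" h c b] by simp
qed

lemma label_decomp:
  assumes "g \<in> carrier G"
  shows "label g \<in> C" "g \<otimes> inv (label g) \<in> H"
proof -
  obtain h b where "h \<in> H" "b \<in> C" "g = h \<otimes> b"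
    using H_mult_C[OF assms] .
  moreover from this have "label g = b" by (intro label_eqI)
  ultimately show "label g \<in> C" "g \<otimes> inv (label g) \<in> H"
    by (simp_all add: m_assoc)
qed

lemma label_C: "b \<in> C \<Longrightarrow> label b = b"
  by (rule label_eqI[of _ \<one>]) auto

lemma label_one_iff: "g \<in> carrier G \<Longrightarrow> label g = \<one> \<longleftrightarrow> g \<in> H"
  using label_decomp(2)[of g] label_eqI[of g g \<one>] by auto

lemma label_mult:
  assumes "x \<in> carrier G" "y \<in> carrier G"
  shows "label (x \<otimes> y) = label x \<otimes> label y"
proof -
  obtain h b where x: "h \<in> H" "b \<in> C" "x = h \<otimes> b" using H_mult_C[OF assms(1)] .
  obtain k c where y: "k \<in> H" "c \<in> C" "y = k \<otimes> c" using H_mult_C[OF assms(2)] .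
  have "x \<otimes> y = (h \<otimes> conjugate b k) \<otimes> (b \<otimes> c)"
    using x y by (simp add: m_assoc inv_solve_left)
  moreover have "h \<otimes> conjugate b k \<in> H" "b \<otimes> c \<in> C"
    using x y conj_H by simp_all
  ultimately have "label (x \<otimes> y) = b \<otimes> c" by (rule label_eqI)
  moreover have "label x = b"
    using x(3,1,2) by (rule label_eqI)
  moreover have "label y = c"
    using y(3,1,2) by (rule label_eqI)
  ultimately show ?thesis by simp
qed

lemma label_conj:
  assumes "x \<in> carrier G" "y \<in> carrier G"
  shows "label (conjugate x y) = label y"
proof -
  have "label (conjugate x y) \<otimes> label x = label (conjugate x y \<otimes> x)"
    using assms by (simp add: label_mult)
  also have "\<dots> = label (x \<otimes> y)"
    using assms by (simp add: m_assoc)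
  also have "\<dots> = label y \<otimes> label x"
    using assms label_decomp(1) by (simp add: label_mult C_commute)
  finally show ?thesis
    using assms label_decomp(1) C.mem_carrier by simp
qed

end


section \<open>Elements of order dividing p in the stabilizer\<close>

text \<open>If \<open>H\<close> is power abelian, then its elements of order dividing \<open>p\<close> form the subgroup \<open>Omega p 1\<close>;
  this makes them accessible to the sections and to conjugation as a normal subgroup.\<close>

locale torsion_virtual_endomorphism = simple_virtual_endomorphism +
  assumes subgroup_torsion': "subgroup {h \<in> H. h [^] p = \<one>} G"
begin

definition torsion :: "'a set" where
  "torsion = {h \<in> H. h [^] p = \<one>}"

lemma subgroup_torsion: "subgroup torsion G"
  unfolding torsion_def by (rule subgroup_torsion')

sublocale T: subgroup torsion G
  by (rule subgroup_torsion)

lemma torsion_le_H: "torsion \<subseteq> H"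
  unfolding torsion_def by blast

lemma torsion_H: "x \<in> torsion \<Longrightarrow> x \<in> H"
  unfolding torsion_def by blast

lemma torsionI: "h \<in> H \<Longrightarrow> h [^] p = \<one> \<Longrightarrow> h \<in> torsion"
  unfolding torsion_def by blast

lemma torsion_pow: "h \<in> torsion \<Longrightarrow> h [^] p = \<one>"
  unfolding torsion_def by blast

lemma conj_torsion: "a \<in> carrier G \<Longrightarrow> x \<in> torsion \<Longrightarrow> conjugate a x \<in> torsion"
  by (rule torsionI) (simp_all add: conj_H torsion_H conj_pow[symmetric] torsion_pow)

lemma sec_torsion:
  "a \<in> carrier G \<Longrightarrow> x \<in> torsion \<Longrightarrow> sec a x \<in> H \<Longrightarrow> sec a x \<in> torsion"
  by (rule torsionI) (simp_all add: sec_pow[symmetric] torsion_H torsion_pow sec_one)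

lemma torsionI_sec_pow:
  assumes "h \<in> H" "\<And>a. a \<in> C \<Longrightarrow> sec a h [^] p = \<one>"
  shows "h \<in> torsion"
proof (rule torsionI[OF assms(1)])
  show "h [^] p = \<one>"
  proof (rule sec_faithful)
    show "h [^] p \<in> H" using assms(1) by (rule subgroup_pow_closed[OF subgroup_H])
    fix a assume "a \<in> C"
    then show "sec a (h [^] p) = \<one>"
      using assms by (simp add: sec_pow)
  qed
qed

lemma torsionI_sec:
  assumes "h \<in> H" "\<And>a. a \<in> C \<Longrightarrow> sec a h \<in> torsion"
  shows "h \<in> torsion"
  using assms(1) by (rule torsionI_sec_pow) (rule torsion_pow[OF assms(2)])

text \<open>All first-level sections, not only \<open>f\<close>, lead from one term of the chain to the next, because
  \<open>C\<close> is contained in the terms up to \<open>height\<close> and normalizes their intersections with \<open>H\<close>.\<close>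

lemma sec_image_chain:
  assumes "j \<le> height" "a \<in> C" "x \<in> image_chain j" "x \<in> H"
  shows "sec a x \<in> image_chain (Suc j)"
proof -
  have "conjugate a x \<in> image_chain j"
    using assms C_le_image_chain[OF assms(1)] subgroup_conj_closed[OF subgroup_image_chain] by blast
  moreover have "conjugate a x \<in> H"
    using assms by (simp add: conj_H)
  ultimately show ?thesis
    by (simp add: sec_def)
qed

lemma below_height_torsion:
  assumes "height = Suc j"
  shows "image_chain j \<inter> H \<subseteq> torsion"
proof
  fix x assume x: "x \<in> image_chain j \<inter> H"
  show "x \<in> torsion"
  proof (rule torsionI_sec_pow)
    show "x \<in> H" using x by blast
    fix a assume a: "a \<in> C"
    then have "sec a x \<in> image_chain (Suc j)"
      using x assms by (intro sec_image_chain) auto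
    then have "sec a x \<in> C"
      unfolding C_def assms .
    then show "sec a x [^] p = \<one>" by (rule C_pow_p)
  qed
qed

lemma conjugation_action:
  assumes A: "subgroup A G" and B: "subgroup B G" and inv: "\<And>b x. b \<in> B \<Longrightarrow> x \<in> A \<Longrightarrow> conjugate b x \<in> A"
  shows "group_action (G\<lparr>carrier := B\<rparr>) A (\<lambda>b. \<lambda>x \<in> A. conjugate b x)"
proof -
  have AG: "x \<in> carrier G" if "x \<in> A" for x
    using subgroup.mem_carrier[OF A that] .
  have BG: "b \<in> carrier G" if "b \<in> B" for b
    using subgroup.mem_carrier[OF B that] .
  have bij: "(\<lambda>x \<in> A. conjugate b x) \<in> Bij A" if b: "b \<in> B" for b
  proof -
    have "bij_betw (\<lambda>x \<in> A. conjugate b x) A A"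
    proof (rule bij_betw_byWitness[where f' = "conjugate (inv b)"])
      have ib: "inv b \<in> B" using b by (rule subgroup.m_inv_closed[OF B])
      show "\<forall>x \<in> A. conjugate (inv b) ((\<lambda>x \<in> A. conjugate b x) x) = x"
        using inv_conj_cancel(1)[OF BG[OF b] AG] by simp
      show "\<forall>x \<in> A. (\<lambda>x \<in> A. conjugate b x) (conjugate (inv b) x) = x"
        using inv_conj_cancel(2)[OF BG[OF b] AG] inv[OF ib] by simp
      show "(\<lambda>x \<in> A. conjugate b x) ` A \<subseteq> A"
        using inv[OF b] by auto
      show "conjugate (inv b) ` A \<subseteq> A"
        using inv[OF ib] by auto
    qed
    then show ?thesis by (simp add: Bij_def)
  qed
  show ?thesis
  proof (intro group_action.intro group_hom.intro group_hom_axioms.intro homI)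
    show "group (G\<lparr>carrier := B\<rparr>)" using B by (rule subgroup_imp_group)
    show "group (BijGroup A)" by (rule group_BijGroup)
    fix b assume "b \<in> carrier (G\<lparr>carrier := B\<rparr>)"
    then have b: "b \<in> B" by simp
    then show "(\<lambda>x \<in> A. conjugate b x) \<in> carrier (BijGroup A)"
      using bij by (simp add: BijGroup_def)
    fix c assume "c \<in> carrier (G\<lparr>carrier := B\<rparr>)"
    then have c: "c \<in> B" by simp
    have eq: "conjugate (b \<otimes> c) x = conjugate b (conjugate c x)" if "x \<in> A" for x
      using conj_conj[OF BG[OF b] BG[OF c] AG[OF that]] by simp
    have "(\<lambda>x \<in> A. conjugate (b \<otimes> c) x) = compose A (\<lambda>x \<in> A. conjugate b x) (\<lambda>x \<in> A. conjugate c x)"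
      unfolding compose_def using eq inv[OF c] by (intro restrict_ext) simp
    then show "(\<lambda>x \<in> A. conjugate (b \<otimes>\<^bsub>G\<lparr>carrier := B\<rparr>\<^esub> c) x) =
        (\<lambda>x \<in> A. conjugate b x) \<otimes>\<^bsub>BijGroup A\<^esub> (\<lambda>x \<in> A. conjugate c x)"
      using bij[OF b] bij[OF c] by (simp add: BijGroup_def)
  qed
qed

text \<open>The intersection of \<open>H\<close> with the term of the chain above \<open>C\<close> is a nontrivial \<open>p\<close>-group on which
  the \<open>p\<close>-group \<open>C\<close> acts by conjugation, so it contains a nontrivial element fixed by \<open>C\<close>. Its sections
  all agree, and they are nontrivial elements of \<open>C\<close>; as \<open>C\<close> has prime order, the fixed elements
  realize each element of \<open>C\<close>.\<close>

lemma constant_sections: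
  assumes height: "height = Suc j" and e: "e \<in> C"
  obtains x where "x \<in> torsion" "\<And>a. a \<in> C \<Longrightarrow> sec a x = e"
proof -
  define A where "A = image_chain j \<inter> H"
  have A: "subgroup A G"
    unfolding A_def using subgroup_image_chain subgroup_H by (rule subgroups_Inter_pair)
  have fA: "f ` A = C"
    unfolding C_def A_def height by simp
  have finA: "finite A"
    using subgroup.subset[OF A] finite_G by (rule finite_subset)
  have inv: "conjugate a x \<in> A" if a: "a \<in> C" and x: "x \<in> A" for a x
  proof -
    have "a \<in> image_chain j" using a C_le_image_chain[of j] height by auto
    then have "conjugate a x \<in> image_chain j"
      using x unfolding A_def by (intro subgroup_conj_closed[OF subgroup_image_chain]) simp_all
    moreover have "conjugate a x \<in> H"
      using x C.mem_carrier[OF a] unfolding A_def by (simp add: conj_H)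
    ultimately show ?thesis unfolding A_def by blast
  qed
  interpret act: group_action "G\<lparr>carrier := C\<rparr>" A "\<lambda>b. \<lambda>x \<in> A. conjugate b x"
    using A subgroup_C inv by (rule conjugation_action)
  define Fix where "Fix = {x \<in> A. \<forall>a \<in> C. conjugate a x = x}"
  have Fix_eq: "{x \<in> A. \<forall>g \<in> carrier (G\<lparr>carrier := C\<rparr>). (\<lambda>x \<in> A. conjugate g x) x = x} = Fix"
    unfolding Fix_def by auto
  have "card A dvd p ^ n"
    using card_subgroup_dvd[OF A subgroup_self subgroup.subset[OF A]] order_G by (simp add: order_def)
  then obtain i where i: "card A = p ^ i"
    using divides_primepow_nat[OF prime_p] by auto
  have "i \<noteq> 0"
  proof
    assume "i = 0"
    then have "card A = 1" using i by simp
    then obtain y where "A = {y}" by (rule card_1_singletonE)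
    then have "C = {f y}" using fA by simp
    then have "card C = 1" by simp
    then show False using card_C prime_gt_1_nat[OF prime_p] by simp
  qed
  then have "p dvd card A" unfolding i by simp
  have ord: "order (G\<lparr>carrier := C\<rparr>) = p ^ 1" by (simp add: order_def card_C)
  have dvd: "p dvd card Fix"
    using act.prime_power_dvd_card_fixed_points[OF prime_p ord finA \<open>p dvd card A\<close>] unfolding Fix_eq .
  have Fix_one: "\<one> \<in> Fix"
    unfolding Fix_def using subgroup.one_closed[OF A] by simp
  have "Fix \<noteq> {\<one>}"
  proof
    assume "Fix = {\<one>}"
    then have "p dvd 1" using dvd by simp
    then show False using prime_gt_1_nat[OF prime_p] by simp
  qed
  then obtain x where x: "x \<in> Fix" "x \<noteq> \<one>" using Fix_one by blast
  have Fix_sub: "subgroup Fix G"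
  proof (rule subgroupI)
    show "Fix \<subseteq> carrier G" unfolding Fix_def using subgroup.subset[OF A] by blast
    show "Fix \<noteq> {}" using Fix_one by blast
    fix y assume y: "y \<in> Fix"
    then have yA: "y \<in> A" and yG: "y \<in> carrier G" and y_fixed: "conjugate a y = y" if "a \<in> C" for a
      using that subgroup.mem_carrier[OF A] unfolding Fix_def by blast+
    have "conjugate a (inv y) = inv y" if "a \<in> C" for a
      using conj_inv[OF C.mem_carrier[OF that] yG[OF that]] unfolding y_fixed[OF that] .
    then show "inv y \<in> Fix"
      using subgroup.m_inv_closed[OF A yA[OF C.one_closed]] unfolding Fix_def by blast
    fix z assume z: "z \<in> Fix"
    then have zA: "z \<in> A" and zG: "z \<in> carrier G" and z_fixed: "conjugate a z = z" if "a \<in> C" for a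
      using that subgroup.mem_carrier[OF A] unfolding Fix_def by blast+
    have "conjugate a (y \<otimes> z) = y \<otimes> z" if "a \<in> C" for a
      using conj_mult[OF C.mem_carrier[OF that] yG[OF that] zG[OF that]]
      unfolding y_fixed[OF that] z_fixed[OF that] .
    then show "y \<otimes> z \<in> Fix"
      using subgroup.m_closed[OF A yA[OF C.one_closed] zA[OF C.one_closed]] unfolding Fix_def by blast
  qed
  have Fix_H: "Fix \<subseteq> H" unfolding Fix_def A_def by blast
  have sec_Fix: "sec a y = f y" if "a \<in> C" "y \<in> Fix" for a y
    using that unfolding Fix_def sec_def by simp
  have "f x \<noteq> \<one>"
  proof
    assume "f x = \<one>"
    moreover have "x \<in> H" using x(1) Fix_H by blast
    ultimately have "x = \<one>"
      using sec_Fix[OF _ x(1)] by (simp add: sec_faithful)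
    then show False using x(2) by simp
  qed
  have "sec \<one> ` Fix = C"
  proof (rule subgroup_of_C)
    show "subgroup (sec \<one> ` Fix) G" using one_closed Fix_sub Fix_H by (rule sec_image_subgroup)
    show "sec \<one> ` Fix \<subseteq> C"
    proof
      fix c assume "c \<in> sec \<one> ` Fix"
      then obtain y where "y \<in> Fix" "c = sec \<one> y" by blast
      then have "c = f y" "y \<in> A" using sec_Fix[OF C.one_closed] unfolding Fix_def by blast+
      then show "c \<in> C" unfolding fA[symmetric] by blast
    qed
    show "f x \<in> sec \<one> ` Fix" using x(1) Fix_H using sec_one_index[of x] by (intro image_eqI[of _ _ x]) auto
  qed fact
  then obtain y where y: "y \<in> Fix" "e = sec \<one> y" using e by blast
  show thesis
  proof (rule that)
    show "y \<in> torsion" using y(1) below_height_torsion[OF height] unfolding Fix_def A_def by blast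
    fix a assume "a \<in> C"
    then show "sec a y = e" using y sec_Fix by simp
  qed
qed

text \<open>\<open>C\<close> acts trivially on \<open>f ` H\<close> modulo \<open>torsion\<close>: if \<open>f x = e\<close> with \<open>x\<close> in \<open>torsion\<close>, then the
  commutator of \<open>e\<close> and \<open>f m\<close> is the image under \<open>f\<close> of the commutator of \<open>x\<close> and \<open>m\<close>, which lies in
  the normal subgroup \<open>torsion\<close>. The image is in \<open>H\<close>, because the quotient by \<open>H\<close> is abelian, and so it
  is again in \<open>torsion\<close>.\<close>

lemma commutator_torsion:
  assumes "height = Suc j" "e \<in> C" "y \<in> image_chain 1"
  shows "conjugate e y \<otimes> inv y \<in> torsion" "conjugate y e \<otimes> inv e \<in> torsion"
proof -
  obtain x where x: "x \<in> torsion" "\<And>a. a \<in> C \<Longrightarrow> sec a x = e"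
    using constant_sections[OF assms(1,2)] by blast
  obtain m where m: "m \<in> H" "y = f m"
    using assms(3) by auto
  have mem: "x \<in> H" "m \<in> carrier G" "x \<in> carrier G" "e \<in> carrier G" "y \<in> carrier G"
    using x(1) m assms(2) torsion_H f_closed by auto
  have e: "f x = e"
    using x(2)[OF C.one_closed] mem by (simp add: sec_one_index)
  let ?k = "x \<otimes> conjugate m (inv x)"
  have k: "?k \<in> torsion"
    using x(1) mem conj_torsion[of m "inv x"] by simp
  have "sec \<one> ?k = sec \<one> x \<otimes> conjugate (sec \<one> m) (inv (sec \<one> x))"
    using mem m conj_H[OF mem(2), of "inv x"] sec_conj[of \<one> "inv x" m] by (simp add: sec_mult sec_inv)
  also have "\<dots> = e \<otimes> conjugate y (inv e)"
    using e m mem by (simp add: sec_one_index)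
  also have "\<dots> = conjugate e y \<otimes> inv y"
    using mem by (simp add: m_assoc)
  finally have eq: "sec \<one> ?k = conjugate e y \<otimes> inv y" .
  have "label (conjugate e y \<otimes> inv y) = label y \<otimes> label (inv y)"
    using mem by (simp add: label_mult[of "conjugate e y" "inv y"] label_conj)
  also have "\<dots> = label (y \<otimes> inv y)"
    using mem by (intro label_mult[symmetric]) simp_all
  also have "\<dots> = \<one>"
    using mem label_C[OF C.one_closed] by simp
  finally have "conjugate e y \<otimes> inv y \<in> H"
    using mem by (simp add: label_one_iff)
  then show *: "conjugate e y \<otimes> inv y \<in> torsion"
    using sec_torsion[OF one_closed k] unfolding eq by blast
  have "conjugate y e \<otimes> inv e = inv (conjugate e y \<otimes> inv y)"
    using mem by (simp add: inv_mult_group m_assoc)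
  then show "conjugate y e \<otimes> inv e \<in> torsion"
    using T.m_inv_closed[OF *] by simp
qed

end


section \<open>Elements that move a vertex\<close>

context torsion_virtual_endomorphism
begin

lemma last_not_torsion:
  assumes "k \<le> height" "\<not> image_chain k \<inter> H \<subseteq> torsion"
  obtains i where "k \<le> i" "i < height" "\<not> image_chain i \<inter> H \<subseteq> torsion"
    "image_chain (Suc i) \<inter> H \<subseteq> torsion"
proof -
  have "\<exists>i. k \<le> i \<and> i < height \<and> \<not> image_chain i \<inter> H \<subseteq> torsion \<and> image_chain (Suc i) \<inter> H \<subseteq> torsion"
  proof (rule ccontr)
    assume none: "\<not> ?thesis"
    from assms(1) have "\<not> image_chain height \<inter> H \<subseteq> torsion"
    proof (induction rule: dec_induct)
      case base
      show ?case by (rule assms(2))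
    next
      case (step i)
      then show ?case using none by blast
    qed
    moreover have "image_chain height \<inter> H \<subseteq> torsion"
      using C_Int_H unfolding C_def by simp
    ultimately show False by contradiction
  qed
  then show thesis using that by blast
qed

text \<open>Modulo \<open>torsion\<close> the sections of \<open>q\<close> lie in \<open>C\<close>, and those of \<open>h\<close> lie in \<open>f ` H\<close>. As these commute
  by \<open>commutator_torsion\<close>, all sections of the commutator of \<open>h\<close> and \<open>q\<close> lie in \<open>torsion\<close>.\<close>

lemma commutator_torsion_H:
  assumes height: "height = Suc j" and "h \<in> H" "q \<in> H"
    and sec_q: "\<And>a. a \<in> C \<Longrightarrow> sec a q \<otimes> inv (label (sec a q)) \<in> torsion"
  shows "conjugate h q \<otimes> inv q \<in> torsion"
proof (rule torsionI_sec)
  have mem: "h \<in> carrier G" "q \<in> carrier G" using assms by simp_all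
  show "conjugate h q \<otimes> inv q \<in> H"
    using assms conj_H[OF mem(1)] by simp
  fix a assume a: "a \<in> C"
  define e where "e = label (sec a q)"
  define t where "t = sec a q \<otimes> inv e"
  define y where "y = sec a h"
  have aG: "a \<in> carrier G" using a by simp
  have secG: "sec a q \<in> carrier G" using aG assms(3) by (rule sec_closed)
  have e: "e \<in> C" "e \<in> carrier G"
    unfolding e_def using label_decomp(1)[OF secG] by simp_all
  have t: "t \<in> torsion" "t \<in> carrier G"
    using sec_q[OF a] unfolding t_def e_def by simp_all
  have y: "y \<in> image_chain 1" "y \<in> carrier G"
    using sec_image_chain[of 0 a h] a assms mem sec_closed[OF aG assms(2)] unfolding y_def by simp_all
  have q: "sec a q = t \<otimes> e"
    unfolding t_def using secG e by (simp add: m_assoc)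
  have "sec a (conjugate h q \<otimes> inv q) = conjugate y (sec a q) \<otimes> inv (sec a q)"
    using aG assms conj_H[OF mem(1)] unfolding y_def by (simp add: sec_mult sec_inv)
  also have "\<dots> = conjugate y (t \<otimes> e) \<otimes> inv (t \<otimes> e)"
    unfolding q ..
  also have "\<dots> = conjugate y t \<otimes> (conjugate y e \<otimes> inv e) \<otimes> inv t"
    using t(2) e(2) y(2) by (simp add: inv_mult_group m_assoc inv_mult_cancel)
  also have "\<dots> \<in> torsion"
    using t(1) conj_torsion[OF y(2) t(1)] commutator_torsion(2)[OF height e(1) y(1)] by simp
  finally show "sec a (conjugate h q \<otimes> inv q) \<in> torsion" .
qed

lemma sec_sec: "a \<in> carrier G \<Longrightarrow> b \<in> carrier G \<Longrightarrow> h \<in> H \<Longrightarrow> sec a (conjugate b h) = sec (a \<otimes> b) h"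
  unfolding sec_def using H.mem_carrier by (simp only: conj_conj)

text \<open>The elements of \<open>C\<close> under which the labels of the sections of \<open>q\<close> are invariant form a
  subgroup, and \<open>C\<close> has no proper nontrivial subgroup.\<close>

lemma label_sec_invariant:
  assumes q: "q \<in> H" and b: "b \<in> C" "b \<noteq> \<one>"
    and inv: "\<And>a. a \<in> C \<Longrightarrow> label (sec (a \<otimes> b) q) = label (sec a q)"
    and a: "a \<in> C"
  shows "label (sec a q) = label (sec \<one> q)"
proof -
  let ?B = "{b \<in> C. \<forall>a \<in> C. label (sec (a \<otimes> b) q) = label (sec a q)}"
  have "subgroup ?B G"
  proof (rule subgroupI)
    show "?B \<subseteq> carrier G" using C.subset by blast
    show "?B \<noteq> {}" using b inv by blast
    fix x assume x: "x \<in> ?B"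
    show "inv x \<in> ?B"
    proof (intro CollectI conjI ballI)
      show "inv x \<in> C" using x by simp
      fix a assume a: "a \<in> C"
      then have "label (sec (a \<otimes> inv x \<otimes> x) q) = label (sec (a \<otimes> inv x) q)"
        using x C.m_closed C.m_inv_closed by blast
      then show "label (sec (a \<otimes> inv x) q) = label (sec a q)"
        using x a by (simp add: m_assoc)
    qed
    fix y assume y: "y \<in> ?B"
    show "x \<otimes> y \<in> ?B"
    proof (intro CollectI conjI ballI)
      show "x \<otimes> y \<in> C" using x y by simp
      fix a assume a: "a \<in> C"
      then have "label (sec (a \<otimes> x \<otimes> y) q) = label (sec (a \<otimes> x) q)"
        using x y C.m_closed by blast
      also have "\<dots> = label (sec a q)" using x a by blast
      finally show "label (sec (a \<otimes> (x \<otimes> y)) q) = label (sec a q)"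
        using x y a by (simp add: m_assoc)
    qed
  qed
  then have "?B = C"
    using b inv by (intro subgroup_of_C[of _ b]) auto
  then have "label (sec (\<one> \<otimes> a) q) = label (sec \<one> q)"
    using a C.one_closed by blast
  then show ?thesis using a by simp
qed

text \<open>Take \<open>q\<close> in \<open>H\<close> outside \<open>torsion\<close> in the last term of the chain for which this is
  possible; then the sections of \<open>q\<close> are elements of \<open>C\<close> modulo \<open>torsion\<close>. For \<open>g\<close> in \<open>F\<close> outside \<open>H\<close>
  the commutator of \<open>g\<close> and \<open>q\<close> lies in \<open>F\<close> and in \<open>torsion\<close>. If all sections of this commutator were in
  \<open>H\<close>, the labels of the sections of \<open>q\<close> would be invariant under a nontrivial rotation of the first
  level, so they would all be equal to one \<open>e\<close>. Dividing \<open>q\<close> by an element of \<open>torsion\<close> whose sections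
  are all \<open>e\<close> would leave an element with sections in \<open>torsion\<close>, and \<open>q\<close> would lie in \<open>torsion\<close>.\<close>

lemma torsion_moves_level:
  assumes k: "0 < k" "k \<le> height" and not_torsion: "\<not> image_chain k \<inter> H \<subseteq> torsion"
    and F: "subgroup F G" "F \<subseteq> image_chain k" "\<not> F \<subseteq> H"
    and normal: "\<And>r x. r \<in> image_chain k \<Longrightarrow> x \<in> F \<Longrightarrow> conjugate r x \<in> F"
  shows "\<not> f ` (F \<inter> torsion) \<subseteq> H"
proof
  assume contra: "f ` (F \<inter> torsion) \<subseteq> H"
  obtain j where height: "height = Suc j"
    using k by (cases height) auto
  obtain i where i: "k \<le> i" "i < height" "\<not> image_chain i \<inter> H \<subseteq> torsion"
      "image_chain (Suc i) \<inter> H \<subseteq> torsion"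
    using last_not_torsion[OF k(2) not_torsion] .
  obtain q where q: "q \<in> image_chain i" "q \<in> H" "q \<notin> torsion"
    using i(3) by blast
  have q_k: "q \<in> image_chain k" using q(1) image_chain_antimono[OF i(1)] by blast
  have q_1: "q \<in> image_chain 1" using q_k image_chain_antimono[of 1 k] k(1) by auto
  have qG: "q \<in> carrier G" using q(2) by simp
  have sec_q: "sec a q \<otimes> inv (label (sec a q)) \<in> torsion" if a: "a \<in> C" for a
  proof -
    have secG: "sec a q \<in> carrier G" using a q(2) by (simp add: sec_closed)
    have "sec a q \<in> image_chain (Suc i)"
      using i(2) a q(1,2) by (intro sec_image_chain) simp_all
    moreover have "label (sec a q) \<in> image_chain (Suc i)"
      using label_decomp(1)[OF secG] C_le_image_chain[of "Suc i"] i(2) by auto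
    ultimately have "sec a q \<otimes> inv (label (sec a q)) \<in> image_chain (Suc i)"
      using subgroup.m_closed[OF subgroup_image_chain] subgroup.m_inv_closed[OF subgroup_image_chain] by blast
    then show ?thesis
      using label_decomp(2)[OF secG] i(4) by blast
  qed
  obtain g where g: "g \<in> F" "g \<notin> H" using F(3) by blast
  have gG: "g \<in> carrier G" using subgroup.mem_carrier[OF F(1) g(1)] .
  obtain h b where hb: "h \<in> H" "b \<in> C" "g = h \<otimes> b"
    using H_mult_C[OF gG] .
  have hG: "h \<in> carrier G" and bG: "b \<in> carrier G" using hb by simp_all
  have b1: "b \<noteq> \<one>"
  proof
    assume "b = \<one>"
    then show False using hb g(2) hG by simp
  qed
  have conj_g: "conjugate g q = conjugate h (conjugate b q)"
    using conj_conj[OF hG bG qG] unfolding hb(3) by simp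
  define y where "y = conjugate g q \<otimes> inv q"
  have yF: "y \<in> F"
  proof -
    have "y = g \<otimes> conjugate q (inv g)"
      unfolding y_def using gG qG by (simp add: m_assoc)
    then show ?thesis
      using normal[OF q_k, of "inv g"] subgroup.m_closed[OF F(1)] subgroup.m_inv_closed[OF F(1)] g(1) by simp
  qed
  have yT: "y \<in> torsion"
  proof -
    have "y = conjugate h (conjugate b q \<otimes> inv q) \<otimes> (conjugate h q \<otimes> inv q)"
      unfolding y_def conj_g using hG bG qG by (simp add: m_assoc inv_mult_cancel)
    moreover have "conjugate h (conjugate b q \<otimes> inv q) \<in> torsion"
      using hG commutator_torsion(1)[OF height hb(2) q_1] by (rule conj_torsion)
    moreover have "conjugate h q \<otimes> inv q \<in> torsion"
      using height hb(1) q(2) sec_q by (rule commutator_torsion_H)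
    ultimately show ?thesis by simp
  qed
  have "label (sec (a \<otimes> b) q) = label (sec a q)" if a: "a \<in> C" for a
  proof -
    have aG: "a \<in> carrier G" using a by simp
    have "conjugate a y \<in> F \<inter> torsion"
      using normal[of a y] a C_le_image_chain[OF k(2)] yF conj_torsion[OF aG yT] by blast
    then have "sec a y \<in> H"
      using contra unfolding sec_def by blast
    then have y1: "label (sec a y) = \<one>"
      using label_one_iff H.mem_carrier by blast
    have "y \<otimes> q = conjugate g q"
      unfolding y_def using gG qG by (simp add: m_assoc)
    then have "sec a y \<otimes> sec a q = sec a (conjugate h (conjugate b q))"
      using aG torsion_H[OF yT] q(2) unfolding conj_g by (simp only: sec_mult[symmetric])
    also have "\<dots> = conjugate (sec a h) (sec a (conjugate b q))"
      using aG conj_H[OF bG q(2)] hb(1) by (rule sec_conj)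
    also have "\<dots> = conjugate (sec a h) (sec (a \<otimes> b) q)"
      using sec_sec[OF aG bG q(2)] by simp
    finally have "label (sec a y \<otimes> sec a q) = label (conjugate (sec a h) (sec (a \<otimes> b) q))"
      by simp
    also have "\<dots> = label (sec (a \<otimes> b) q)"
      using aG bG hb(1) q(2) by (intro label_conj sec_closed) simp_all
    also have "label (sec a y \<otimes> sec a q) = label (sec a y) \<otimes> label (sec a q)"
      using aG q(2) torsion_H[OF yT] by (intro label_mult sec_closed)
    also have "\<dots> = label (sec a q)"
      using y1 label_decomp(1)[OF sec_closed[OF aG q(2)]] by simp
    finally show ?thesis by simp
  qed
  then have label_const: "label (sec a q) = label (sec \<one> q)" if "a \<in> C" for a
    using label_sec_invariant[OF q(2) hb(2) b1 _ that] by blast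
  have "label (sec \<one> q) \<in> C"
    using label_decomp(1) sec_closed[OF one_closed q(2)] by blast
  then obtain x where x: "x \<in> torsion" "\<And>a. a \<in> C \<Longrightarrow> sec a x = label (sec \<one> q)"
    using constant_sections[OF height] by blast
  have xH: "x \<in> H" "x \<in> carrier G" using x(1) torsion_H by simp_all
  have "q \<otimes> inv x \<in> torsion"
  proof (rule torsionI_sec)
    show "q \<otimes> inv x \<in> H" using q(2) xH by simp
    fix a assume a: "a \<in> C"
    have "sec a (q \<otimes> inv x) = sec a q \<otimes> inv (sec a x)"
      using a q(2) xH by (simp add: sec_mult sec_inv)
    also have "\<dots> = sec a q \<otimes> inv (label (sec a q))"
      using x(2)[OF a] label_const[OF a] by simp
    finally show "sec a (q \<otimes> inv x) \<in> torsion"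
      using sec_q[OF a] by simp
  qed
  then have "q \<otimes> inv x \<otimes> x \<in> torsion"
    using x(1) by simp
  then show False
    using q(3) qG xH by (simp add: m_assoc)
qed

end


section \<open>Counting p-th powers\<close>

context torsion_virtual_endomorphism
begin

definition power_span :: "'a set \<Rightarrow> 'a set" where
  "power_span L = generate G ((\<lambda>x. x [^] p) ` L)"

lemma subgroup_power_span: "L \<subseteq> carrier G \<Longrightarrow> subgroup (power_span L) G"
  unfolding power_span_def by (rule generate_is_subgroup) auto

lemma power_span_mono: "L \<subseteq> K \<Longrightarrow> power_span L \<subseteq> power_span K"
  unfolding power_span_def by (intro mono_generate image_mono)

lemma power_span_le: "subgroup K G \<Longrightarrow> L \<subseteq> K \<Longrightarrow> power_span L \<subseteq> K"
  unfolding power_span_def by (rule generate_subgroup_incl) (auto intro: subgroup_pow_closed)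

lemma power_in_power_span: "x \<in> L \<Longrightarrow> x [^] p \<in> power_span L"
  unfolding power_span_def by (intro generate.incl imageI)

lemma finite_subgroup: "subgroup K G \<Longrightarrow> finite K"
  using subgroup.subset finite_G by (rule finite_subset)

lemma card_power_span_pos: "L \<subseteq> carrier G \<Longrightarrow> card (power_span L) > 0"
  using finite_subgroup[OF subgroup_power_span] subgroup.one_closed[OF subgroup_power_span]
  by (auto simp: card_gt_0_iff)

text \<open>Admissible subgroups are those to which the induction on the level applies: their images
  under the sections are normal in the next term of the chain.\<close>

definition admissible :: "nat \<Rightarrow> 'a set \<Rightarrow> bool" where
  "admissible j L \<longleftrightarrow> subgroup L G \<and> L \<subseteq> image_chain j \<inter> H \<and>
     (\<forall>r \<in> image_chain j \<inter> H. \<forall>x \<in> L. conjugate r x \<in> L)"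

lemma card_le_p_mult_Int_H:
  assumes F: "subgroup F G"
  shows "card F \<le> p * card (F \<inter> H)"
proof -
  have FG: "x \<in> carrier G" if "x \<in> F" for x
    using subgroup.mem_carrier[OF F that] .
  have "group_hom (G\<lparr>carrier := F\<rparr>) G label"
  proof (rule group_hom.intro[OF subgroup_imp_group[OF F] is_group group_hom_axioms.intro])
    show "label \<in> hom (G\<lparr>carrier := F\<rparr>) G"
    proof (rule homI)
      fix x assume "x \<in> carrier (G\<lparr>carrier := F\<rparr>)"
      then have x: "x \<in> carrier G" using FG by simp
      then show "label x \<in> carrier G" using label_decomp(1) C.mem_carrier by blast
      fix y assume "y \<in> carrier (G\<lparr>carrier := F\<rparr>)"
      then have y: "y \<in> carrier G" using FG by simp
      then show "label (x \<otimes>\<^bsub>G\<lparr>carrier := F\<rparr>\<^esub> y) = label x \<otimes> label y"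
        using label_mult x by simp
    qed
  qed
  from card_hom_preimage[OF this _ subset_refl]
  have "card {x \<in> F. label x \<in> label ` F} = card (label ` F) * card {x \<in> F. label x = \<one>}"
    using finite_subgroup[OF F] by simp
  moreover have "{x \<in> F. label x \<in> label ` F} = F" by blast
  moreover have "{x \<in> F. label x = \<one>} = F \<inter> H"
    using label_one_iff FG by blast
  moreover have "card (label ` F) \<le> p"
  proof -
    have "label ` F \<subseteq> C" using label_decomp(1) FG by blast
    then show ?thesis using card_mono[OF finite_subgroup[OF subgroup_C]] card_C by simp
  qed
  ultimately show ?thesis by simp
qed

lemma admissible_sec_image:
  assumes j: "j < height" and L: "admissible j L" and a: "a \<in> C"
  shows "subgroup (sec a ` L) G" "sec a ` L \<subseteq> image_chain (Suc j)"
    "r \<in> image_chain (Suc j) \<Longrightarrow> y \<in> sec a ` L \<Longrightarrow> conjugate r y \<in> sec a ` L"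
proof -
  have L': "subgroup L G" "L \<subseteq> image_chain j" "L \<subseteq> H"
    using L unfolding admissible_def by simp_all
  have aG: "a \<in> carrier G" using a by simp
  show "subgroup (sec a ` L) G"
    using aG L'(1,3) by (rule sec_image_subgroup)
  show "sec a ` L \<subseteq> image_chain (Suc j)"
    using j a L' by (auto intro: sec_image_chain[of j, simplified image_chain.simps] simp del: image_chain.simps simp: image_chain.simps)
  assume r: "r \<in> image_chain (Suc j)" and y: "y \<in> sec a ` L"
  obtain s where s: "s \<in> image_chain j" "s \<in> H" "r = f s"
    using r by auto
  obtain x where x: "x \<in> L" "y = sec a x" using y by blast
  have aj: "a \<in> image_chain j" "inv a \<in> image_chain j"
    using C_le_image_chain[of j] j a by auto
  have sG: "s \<in> carrier G" using s by simp
  \<comment> \<open>Conjugating \<open>s\<close> back by \<open>a\<close> turns a preimage under \<open>f\<close> into a preimage under \<open>sec a\<close>.\<close>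
  define t where "t = conjugate (inv a) s"
  have t: "t \<in> image_chain j" "t \<in> H"
    unfolding t_def using subgroup_conj_closed[OF subgroup_image_chain aj(2) s(1)] conj_H[of "inv a" s] aG s(2) by simp_all
  have at: "conjugate a t = s"
    unfolding t_def using inv_conj_cancel(2)[OF aG sG] .
  have "conjugate t x \<in> L"
    using L t x(1) unfolding admissible_def by blast
  moreover have "sec a (conjugate t x) = conjugate r y"
    using sec_conj[OF aG _ t(2), of x] x L'(3) at s(3) unfolding sec_def[of a t] by auto
  ultimately show "conjugate r y \<in> sec a ` L" by force
qed

lemma admissible_sec_torsion:
  assumes j: "j < height" and L: "admissible j L" and a: "a \<in> C"
  shows "admissible j {x \<in> L. sec a x \<in> torsion}" (is "admissible j ?K")
proof -
  have L': "subgroup L G" "L \<subseteq> image_chain j" "L \<subseteq> H"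
    using L unfolding admissible_def by simp_all
  have aG: "a \<in> carrier G" using a by simp
  have LH: "x \<in> H" if "x \<in> L" for x using L'(3) that by blast
  show ?thesis
    unfolding admissible_def
  proof (intro conjI ballI)
    show "subgroup ?K G"
    proof (rule subgroupI)
      show "?K \<subseteq> carrier G" using L'(3) H.subset by blast
      show "?K \<noteq> {}"
        using subgroup.one_closed[OF L'(1)] sec_one[OF aG] T.one_closed by auto
      fix x assume x: "x \<in> ?K"
      then show "inv x \<in> ?K"
        using LH sec_inv[OF aG] subgroup.m_inv_closed[OF L'(1)] by simp
      fix y assume y: "y \<in> ?K"
      show "x \<otimes> y \<in> ?K"
        using x y LH sec_mult[OF aG] subgroup.m_closed[OF L'(1)] by simp
    qed
    show "?K \<subseteq> image_chain j \<inter> H" using L' by blast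
    fix r x assume r: "r \<in> image_chain j \<inter> H" and x: "x \<in> ?K"
    then have "conjugate r x \<in> L" using L unfolding admissible_def by blast
    moreover have "sec a (conjugate r x) = conjugate (sec a r) (sec a x)"
      using r x LH by (intro sec_conj[OF aG]) auto
    moreover have "conjugate (sec a r) (sec a x) \<in> torsion"
      using r x by (intro conj_torsion sec_closed[OF aG]) auto
    ultimately show "conjugate r x \<in> ?K" by simp
  qed
qed

text \<open>Both parts compare a group with its image and its kernel under the section \<open>sec a\<close>.\<close>

lemma card_sec_image:
  assumes L: "subgroup L G" "L \<subseteq> H" and a: "a \<in> C"
  shows "card L * card (sec a ` L \<inter> torsion) = card {x \<in> L. sec a x \<in> torsion} * card (sec a ` L)"
    "card (power_span (sec a ` L)) * card (power_span {x \<in> L. sec a x \<in> torsion}) \<le> card (power_span L)"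
proof -
  have aG: "a \<in> carrier G" using a by simp
  have LH: "x \<in> H" if "x \<in> L" for x using L(2) that by blast
  have pre: "card {x \<in> K. sec a x \<in> B} = card B * card {x \<in> K. sec a x = \<one>}"
    if K: "subgroup K G" "K \<subseteq> H" "B \<subseteq> sec a ` K" for K B
    using card_hom_preimage[OF group_hom_sec[OF aG K(1,2)], of B] finite_subgroup[OF K(1)] K(3) by simp
  have "card {x \<in> L. sec a x \<in> sec a ` L} = card (sec a ` L) * card {x \<in> L. sec a x = \<one>}"
    using L subset_refl by (rule pre)
  moreover have "{x \<in> L. sec a x \<in> sec a ` L} = L" by blast
  moreover have "card {x \<in> L. sec a x \<in> sec a ` L \<inter> torsion} =
      card (sec a ` L \<inter> torsion) * card {x \<in> L. sec a x = \<one>}"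
    using L Int_lower1 by (rule pre)
  moreover have "{x \<in> L. sec a x \<in> sec a ` L \<inter> torsion} = {x \<in> L. sec a x \<in> torsion}" by blast
  ultimately show "card L * card (sec a ` L \<inter> torsion) = card {x \<in> L. sec a x \<in> torsion} * card (sec a ` L)"
    by simp
  let ?U = "power_span L" and ?K = "{x \<in> L. sec a x \<in> torsion}"
  have LG: "L \<subseteq> carrier G" using L(1) by (rule subgroup.subset)
  have U: "subgroup ?U G" using LG by (rule subgroup_power_span)
  have U_H: "?U \<subseteq> H" using subgroup_H L(2) by (rule power_span_le)
  have "card {x \<in> ?U. sec a x \<in> sec a ` ?U} = card (sec a ` ?U) * card {x \<in> ?U. sec a x = \<one>}"
    using U U_H subset_refl by (rule pre)
  moreover have "{x \<in> ?U. sec a x \<in> sec a ` ?U} = ?U" by blast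
  ultimately have cardU: "card ?U = card (sec a ` ?U) * card {x \<in> ?U. sec a x = \<one>}" by simp
  have "power_span (sec a ` L) \<subseteq> sec a ` ?U"
    unfolding power_span_def[of "sec a ` L"]
  proof (rule generate_subgroup_incl)
    show "subgroup (sec a ` ?U) G" using aG U U_H by (rule sec_image_subgroup)
    show "(\<lambda>x. x [^] p) ` sec a ` L \<subseteq> sec a ` ?U"
    proof clarify
      fix x assume x: "x \<in> L"
      have "sec a x [^] p = sec a (x [^] p)"
        using sec_pow[OF aG LH[OF x]] by simp
      then show "sec a x [^] p \<in> sec a ` ?U"
        using power_in_power_span[OF x] by simp
    qed
  qed
  then have le1: "card (power_span (sec a ` L)) \<le> card (sec a ` ?U)"
    by (intro card_mono finite_imageI finite_subgroup[OF U])
  have ker: "subgroup {x \<in> ?U. sec a x = \<one>} G"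
  proof (rule subgroupI)
    have UH: "x \<in> H" if "x \<in> ?U" for x using U_H that by blast
    show "{x \<in> ?U. sec a x = \<one>} \<subseteq> carrier G" using U_H H.subset by blast
    show "{x \<in> ?U. sec a x = \<one>} \<noteq> {}"
      using subgroup.one_closed[OF U] sec_one[OF aG] by auto
    fix x assume x: "x \<in> {x \<in> ?U. sec a x = \<one>}"
    then show "inv x \<in> {x \<in> ?U. sec a x = \<one>}"
      using UH sec_inv[OF aG] subgroup.m_inv_closed[OF U] by simp
    fix y assume y: "y \<in> {x \<in> ?U. sec a x = \<one>}"
    show "x \<otimes> y \<in> {x \<in> ?U. sec a x = \<one>}"
      using x y UH sec_mult[OF aG] subgroup.m_closed[OF U] by simp
  qed
  have "power_span ?K \<subseteq> {x \<in> ?U. sec a x = \<one>}"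
    unfolding power_span_def[of ?K]
  proof (rule generate_subgroup_incl[OF _ ker])
    show "(\<lambda>x. x [^] p) ` ?K \<subseteq> {x \<in> ?U. sec a x = \<one>}"
    proof clarify
      fix x assume x: "x \<in> L" "sec a x \<in> torsion"
      then show "x [^] p \<in> ?U \<and> sec a (x [^] p) = \<one>"
        using power_in_power_span[OF x(1)] sec_pow[OF aG LH[OF x(1)]] torsion_pow[OF x(2)] by simp
    qed
  qed
  then have le2: "card (power_span ?K) \<le> card {x \<in> ?U. sec a x = \<one>}"
    by (intro card_mono finite_subgroup[OF ker])
  show "card (power_span (sec a ` L)) * card (power_span ?K) \<le> card ?U"
    unfolding cardU using le1 le2 by (rule mult_le_mono)
qed

text \<open>The first inequality compares \<open>L\<close> with its subgroup generated by \<open>p\<close>-th powers as the third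
  condition for power abelian groups does. The second one says that a factor \<open>p\<close> is gained when \<open>L\<close> is
  invariant under \<open>C\<close> and some element of order \<open>p\<close> in \<open>L\<close> acts nontrivially on the second level. The gain
  is what contradicts that condition for \<open>L = H\<close>, and it is needed in the induction as well: there it
  compensates for the index of \<open>F \<inter> H\<close> in a section group \<open>F\<close> that is not contained in \<open>H\<close>.\<close>

definition power_bound :: "nat \<Rightarrow> bool" where
  "power_bound j \<longleftrightarrow> (\<forall>L. admissible j L \<longrightarrow>
     card L \<le> card (power_span L) * card (L \<inter> torsion) \<and>
     ((\<forall>a \<in> C. \<forall>x \<in> L. conjugate a x \<in> L) \<longrightarrow> \<not> L \<subseteq> torsion \<longrightarrow> \<not> f ` (L \<inter> torsion) \<subseteq> H \<longrightarrow>
       p * card L \<le> card (power_span L) * card (L \<inter> torsion)))"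

text \<open>If the image \<open>F\<close> of \<open>L\<close> lies in \<open>H\<close>, the bound one level further down applies. Otherwise \<open>F \<inter> H\<close>
  has index \<open>p\<close> in \<open>F\<close>. If \<open>F \<inter> H\<close> lies in \<open>torsion\<close>, it suffices that some \<open>p\<close>-th power in \<open>F\<close> is
  nontrivial; if it does not, then \<open>torsion_moves_level\<close> makes the gain of \<open>p\<close> available for \<open>F \<inter> H\<close>.\<close>

lemma sec_image_bound:
  assumes j: "j < height" and L: "admissible j L" and a: "a \<in> C"
    and IH: "power_bound (Suc j)"
    and nontrivial: "y \<in> sec a ` L" "y [^] p \<noteq> \<one>"
  shows "card (sec a ` L) \<le> card (power_span (sec a ` L)) * card (sec a ` L \<inter> torsion)"
proof -
  define F where "F = sec a ` L"
  have F: "subgroup F G" and F_le: "F \<subseteq> image_chain (Suc j)"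
    and F_normal: "\<And>r x. r \<in> image_chain (Suc j) \<Longrightarrow> x \<in> F \<Longrightarrow> conjugate r x \<in> F"
    unfolding F_def using admissible_sec_image[OF j L a] by blast+
  have FG: "F \<subseteq> carrier G" using F by (rule subgroup.subset)
  have F0: "subgroup (F \<inter> H) G"
    using F subgroup_H by (rule subgroups_Inter_pair)
  have adm: "admissible (Suc j) (F \<inter> H)"
    unfolding admissible_def
  proof (intro conjI ballI)
    show "F \<inter> H \<subseteq> image_chain (Suc j) \<inter> H" using F_le by blast
    fix r x assume r: "r \<in> image_chain (Suc j) \<inter> H" and x: "x \<in> F \<inter> H"
    then show "conjugate r x \<in> F \<inter> H"
      using F_normal[of r x] subgroup_conj_closed[OF subgroup_H, of r x] by blast
  qed (rule F0)
  have int: "(F \<inter> H) \<inter> torsion = F \<inter> torsion"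
    using torsion_le_H by blast
  have span_le: "card (power_span (F \<inter> H)) \<le> card (power_span F)"
    by (intro card_mono finite_subgroup subgroup_power_span FG power_span_mono Int_lower1)
  have "card F \<le> card (power_span F) * card (F \<inter> torsion)"
  proof (cases "F \<subseteq> H")
    case True
    then have "F \<inter> H = F" by blast
    then show ?thesis using IH adm unfolding power_bound_def by simp
  next
    case not_H: False
    show ?thesis
    proof (cases "F \<inter> H \<subseteq> torsion")
      case True
      then have "F \<inter> torsion = F \<inter> H" using torsion_le_H by blast
      moreover have "p * card {\<one>} \<le> card (power_span F)"
      proof (rule prime_power_index[OF prime_p finite_G order_G triv_subgroup subgroup_power_span[OF FG]])
        show "{\<one>} \<subset> power_span F"
          using nontrivial power_in_power_span[of y F] subgroup.one_closed[OF subgroup_power_span[OF FG]]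
          unfolding F_def by blast
      qed
      then have "p \<le> card (power_span F)" by simp
      then have "p * card (F \<inter> H) \<le> card (power_span F) * card (F \<inter> H)"
        by (rule mult_le_mono1)
      ultimately show ?thesis
        using order_trans[OF card_le_p_mult_Int_H[OF F]] by simp
    next
      case False
      have "\<not> image_chain (Suc j) \<inter> H \<subseteq> torsion"
        using False F_le by blast
      then have "\<not> f ` (F \<inter> torsion) \<subseteq> H"
        using j F F_le not_H F_normal by (intro torsion_moves_level[of "Suc j"]) auto
      moreover have "\<forall>a \<in> C. \<forall>x \<in> F \<inter> H. conjugate a x \<in> F \<inter> H"
      proof (intro ballI)
        fix b x assume "b \<in> C" "x \<in> F \<inter> H"
        then show "conjugate b x \<in> F \<inter> H"
          using F_normal[of b x] C_le_image_chain[of "Suc j"] j conj_H[of b x] C.mem_carrier[of b] by auto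
      qed
      ultimately have "p * card (F \<inter> H) \<le> card (power_span (F \<inter> H)) * card (F \<inter> torsion)"
        using IH adm False unfolding power_bound_def int[symmetric] by blast
      also have "\<dots> \<le> card (power_span F) * card (F \<inter> torsion)"
        using span_le by (rule mult_le_mono1)
      finally show ?thesis
        by (rule order_trans[OF card_le_p_mult_Int_H[OF F]])
    qed
  qed
  then show ?thesis unfolding F_def .
qed

text \<open>An element of \<open>L\<close> outside \<open>torsion\<close> has a nontrivial \<open>p\<close>-th power, which is seen by some
  section \<open>sec a\<close>. The bounds for the image of \<open>L\<close> and for the subgroup of those elements whose section
  lies in \<open>torsion\<close> multiply to a bound for \<open>L\<close>. The torsion part of that subgroup may be smaller than
  that of \<open>L\<close>, which is the source of the gain.\<close>

lemma refined_bound: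
  assumes j: "j < height" and L: "admissible j L" and IH: "power_bound (Suc j)"
    and not_torsion: "\<not> L \<subseteq> torsion"
    and smaller: "\<And>K. admissible j K \<Longrightarrow> card K < card L \<Longrightarrow> card K \<le> card (power_span K) * card (K \<inter> torsion)"
  obtains a where "a \<in> C"
    "card L \<le> card (power_span L) * card ({x \<in> L. sec a x \<in> torsion} \<inter> torsion)"
proof -
  have L': "subgroup L G" "L \<subseteq> H"
    using L unfolding admissible_def by simp_all
  obtain l where l: "l \<in> L" "l \<notin> torsion" using not_torsion by blast
  then have lH: "l \<in> H" using L'(2) by blast
  obtain a where a: "a \<in> C" "sec a l [^] p \<noteq> \<one>"
    using torsionI_sec_pow[OF lH] l(2) by blast
  define F K where "F = sec a ` L" and "K = {x \<in> L. sec a x \<in> torsion}"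
  have K: "admissible j K"
    unfolding K_def using j L a(1) by (rule admissible_sec_torsion)
  have "l \<notin> K"
    using a(2) torsion_pow unfolding K_def by blast
  then have "card K < card L"
    using l(1) by (intro psubset_card_mono finite_subgroup L') (auto simp: K_def)
  then have K_bound: "card K \<le> card (power_span K) * card (K \<inter> torsion)"
    using K smaller by blast
  have F_bound: "card F \<le> card (power_span F) * card (F \<inter> torsion)"
    unfolding F_def using sec_image_bound[OF j L a(1) IH _ a(2)] l(1) by blast
  have F: "subgroup F G"
    unfolding F_def using C.mem_carrier[OF a(1)] L' by (rule sec_image_subgroup)
  have pos: "card (F \<inter> torsion) > 0"
    using finite_subgroup[OF F] subgroup.one_closed[OF F] T.one_closed by (auto simp: card_gt_0_iff)
  have count: "card L * card (F \<inter> torsion) = card K * card F"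
    "card (power_span F) * card (power_span K) \<le> card (power_span L)"
    unfolding F_def K_def using card_sec_image[OF L' a(1)] by blast+
  have "card L * card (F \<inter> torsion) \<le>
      (card (power_span K) * card (K \<inter> torsion)) * (card (power_span F) * card (F \<inter> torsion))"
    unfolding count(1) using K_bound F_bound by (rule mult_le_mono)
  also have "\<dots> = (card (power_span F) * card (power_span K)) * card (K \<inter> torsion) * card (F \<inter> torsion)"
    by (simp only: mult_ac)
  also have "\<dots> \<le> card (power_span L) * card (K \<inter> torsion) * card (F \<inter> torsion)"
    using count(2) by (intro mult_le_mono1)
  finally have "card L \<le> card (power_span L) * card (K \<inter> torsion)"
    using pos by simp
  then show thesis
    using that[OF a(1)] unfolding K_def by blast
qed

lemma power_bound_step:
  assumes j: "j < height" and IH: "power_bound (Suc j)"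
  shows "power_bound j"
proof -
  have weak: "card L \<le> card (power_span L) * card (L \<inter> torsion)" if "admissible j L" for L
    using that
  proof (induction "card L" arbitrary: L rule: less_induct)
    case less
    have L': "subgroup L G" "L \<subseteq> carrier G"
      using less.prems subgroup.subset unfolding admissible_def by blast+
    show ?case
    proof (cases "L \<subseteq> torsion")
      case True
      then have "L \<inter> torsion = L" by blast
      then show ?thesis using card_power_span_pos[OF L'(2)] by simp
    next
      case False
      then obtain a where a: "a \<in> C"
        "card L \<le> card (power_span L) * card ({x \<in> L. sec a x \<in> torsion} \<inter> torsion)"
        using refined_bound[OF j less.prems IH] less.hyps by blast
      have "card ({x \<in> L. sec a x \<in> torsion} \<inter> torsion) \<le> card (L \<inter> torsion)"
        using finite_subgroup[OF L'(1)] by (intro card_mono) auto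
      with a(2) show ?thesis
        using mult_le_mono2 order_trans by blast
    qed
  qed
  moreover have "p * card L \<le> card (power_span L) * card (L \<inter> torsion)"
    if L: "admissible j L" and inv: "\<forall>a \<in> C. \<forall>x \<in> L. conjugate a x \<in> L"
      and not_torsion: "\<not> L \<subseteq> torsion" and moves: "\<not> f ` (L \<inter> torsion) \<subseteq> H" for L
  proof -
    have L': "subgroup L G" "L \<subseteq> H" "L \<subseteq> carrier G"
      using L subgroup.subset unfolding admissible_def by blast+
    obtain a where a: "a \<in> C"
        "card L \<le> card (power_span L) * card ({x \<in> L. sec a x \<in> torsion} \<inter> torsion)"
      using refined_bound[OF j L IH not_torsion] weak by blast
    let ?K = "{x \<in> L. sec a x \<in> torsion}"
    have aG: "a \<in> carrier G" using a(1) by simp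
    have K: "subgroup ?K G"
      using admissible_sec_torsion[OF j L a(1)] unfolding admissible_def by blast
    have "?K \<inter> torsion \<subset> L \<inter> torsion"
    proof -
      obtain y where y: "y \<in> L" "y \<in> torsion" "f y \<notin> H" using moves by blast
      have yG: "y \<in> carrier G" using y(2) by simp
      let ?z = "conjugate (inv a) y"
      have "sec a ?z = f y"
        unfolding sec_def using inv_conj_cancel(2)[OF aG yG] by simp
      then have "?z \<notin> ?K" using y(3) torsion_le_H by auto
      moreover have "?z \<in> L" using inv y(1) C.m_inv_closed[OF a(1)] by blast
      moreover have "?z \<in> torsion" using conj_torsion[of "inv a" y] aG y(2) by simp
      ultimately show ?thesis by blast
    qed
    then have index: "p * card (?K \<inter> torsion) \<le> card (L \<inter> torsion)"
      by (rule prime_power_index[OF prime_p finite_G order_G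
            subgroups_Inter_pair[OF K subgroup_torsion] subgroups_Inter_pair[OF L'(1) subgroup_torsion]])
    have "p * card L \<le> p * (card (power_span L) * card (?K \<inter> torsion))"
      using a(2) by (rule mult_le_mono2)
    also have "\<dots> = card (power_span L) * (p * card (?K \<inter> torsion))"
      by (simp only: mult_ac)
    also have "\<dots> \<le> card (power_span L) * card (L \<inter> torsion)"
      using index by (rule mult_le_mono2)
    finally show ?thesis .
  qed
  ultimately show ?thesis unfolding power_bound_def by blast
qed

lemma power_bound: "j \<le> height \<Longrightarrow> power_bound j"
proof (induction rule: inc_induct)
  case base
  show ?case
    unfolding power_bound_def
  proof (intro allI impI conjI)
    fix L assume L: "admissible height L"
    have L': "L \<subseteq> carrier G"
      using L subgroup.subset unfolding admissible_def by blast
    have "L \<subseteq> {\<one>}"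
      using L C_Int_H unfolding admissible_def C_def by blast
    then have torsion: "L \<subseteq> torsion" by auto
    then have "L \<inter> torsion = L" by blast
    then show "card L \<le> card (power_span L) * card (L \<inter> torsion)"
      using card_power_span_pos[OF L'] by simp
    assume "\<not> L \<subseteq> torsion"
    then show "p * card L \<le> card (power_span L) * card (L \<inter> torsion)"
      using torsion by contradiction
  qed
next
  case (step j)
  show ?case using step.hyps(2) step.IH by (rule power_bound_step)
qed

text \<open>The constant elements of \<open>torsion\<close> act nontrivially on the second level, so \<open>H\<close> itself
  satisfies the hypotheses under which a factor \<open>p\<close> is gained.\<close>

lemma many_powers:
  assumes "\<not> H \<subseteq> torsion"
  shows "p * card H \<le> card (power_span H) * card torsion"
proof -
  have "height \<noteq> 0"
  proof
    assume "height = 0"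
    then have "C = carrier G" by (simp add: C_def)
    then have "H \<subseteq> {\<one>}" using C_Int_H H.subset by blast
    then show False using assms T.one_closed by blast
  qed
  then obtain j where height: "height = Suc j" by (cases height) auto
  have adm: "admissible 0 H"
    unfolding admissible_def using subgroup_H H.subset subgroup_conj_closed[OF subgroup_H] by simp
  have inv: "\<forall>a \<in> C. \<forall>x \<in> H. conjugate a x \<in> H"
    using conj_H C.mem_carrier by blast
  have int: "H \<inter> torsion = torsion"
    using torsion_le_H by blast
  obtain e where e: "e \<in> C" "e \<notin> H" using C_not_le_H by blast
  obtain x where x: "x \<in> torsion" "\<And>a. a \<in> C \<Longrightarrow> sec a x = e"
    using constant_sections[OF height e(1)] by blast
  have "f x = e"
    using x(2)[OF C.one_closed] torsion_H[OF x(1)] by (simp add: sec_one_index)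
  then have "\<not> f ` (H \<inter> torsion) \<subseteq> H"
    unfolding int using x(1) e(2) by blast
  moreover have "power_bound 0" by (rule power_bound) simp
  ultimately have "p * card H \<le> card (power_span H) * card (H \<inter> torsion)"
    using adm inv assms unfolding power_bound_def by blast
  then show ?thesis unfolding int .
qed

lemma H_eq_torsion:
  assumes "card (power_span H) = card (rcosets\<^bsub>G\<lparr>carrier := H\<rparr>\<^esub> torsion)"
  shows "H = torsion"
proof (rule ccontr)
  assume "H \<noteq> torsion"
  then have "\<not> H \<subseteq> torsion" using torsion_le_H by blast
  then have "p * card H \<le> card (power_span H) * card torsion" by (rule many_powers)
  also have "\<dots> = card H"
  proof -
    interpret HG: group "G\<lparr>carrier := H\<rparr>"
      using subgroup_H by (rule subgroup_imp_group)
    have "subgroup torsion (G\<lparr>carrier := H\<rparr>)"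
      using subgroup_torsion subgroup_H torsion_le_H by (rule subgroup_incl)
    from HG.lagrange[OF this] show ?thesis
      unfolding assms order_def by simp
  qed
  finally show False
    using card_H_pos prime_gt_1_nat[OF prime_p] by simp
qed

end


section \<open>From tree automorphisms to virtual endomorphisms\<close>

text \<open>The setting in which the first-level stabilizer and the section at the vertex \<open>0\<close> are shown to form
  a simple virtual endomorphism.\<close>

locale self_similar_p_group = group G for G (structure) +
  fixes p n :: nat and \<rho>
  assumes prime_p: "Factorial_Ring.prime p"
    and finite_G: "finite (carrier G)"
    and order_G: "order G = p ^ n"
    and rep: "self_similar_rep G p \<rho>"
begin

abbreviation perm :: "'a \<Rightarrow> nat \<Rightarrow> nat" where
  "perm g \<equiv> level1_perm (\<rho> g)"

abbreviation stab :: "'a set" where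
  "stab \<equiv> first_level_stabilizer G p \<rho>"

lemma p_pos: "0 < p"
  using prime_p by (rule prime_gt_0_nat)

lemma rep_hom: "\<rho> \<in> hom G (TreeAut p)"
  and rep_inj: "inj_on \<rho> (carrier G)"
  and rep_state_closed: "state_closed p (\<rho> ` carrier G)"
  and rep_transitive: "level1_transitive p (\<rho> ` carrier G)"
  using rep unfolding self_similar_rep_def mon_def by simp_all

lemma rep_aut: "g \<in> carrier G \<Longrightarrow> \<rho> g \<in> tree_auts p"
  using hom_in_carrier[OF rep_hom] by (simp add: TreeAut_def)

lemma rep_extensional: "g \<in> carrier G \<Longrightarrow> \<rho> g \<in> extensional (tree_verts p)"
  using rep_aut unfolding tree_auts_def Bij_def by blast

lemma rep_verts: "g \<in> carrier G \<Longrightarrow> u \<in> tree_verts p \<Longrightarrow> \<rho> g u \<in> tree_verts p"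
  using tree_auts_closed[OF rep_aut] .

lemma rep_mult:
  assumes "g \<in> carrier G" "h \<in> carrier G" "u \<in> tree_verts p"
  shows "\<rho> (g \<otimes> h) u = \<rho> g (\<rho> h u)"
proof -
  have "\<rho> g \<in> Bij (tree_verts p)" "\<rho> h \<in> Bij (tree_verts p)"
    using rep_aut assms(1,2) unfolding tree_auts_def by blast+
  then have "\<rho> (g \<otimes> h) = compose (tree_verts p) (\<rho> g) (\<rho> h)"
    using hom_mult[OF rep_hom assms(1,2)] by (simp add: TreeAut_def BijGroup_def)
  then show ?thesis
    using assms(3) by (simp add: compose_eq)
qed

lemma rep_one:
  assumes "u \<in> tree_verts p"
  shows "\<rho> \<one> u = u"
proof -
  have "\<rho> \<one> (\<rho> \<one> u) = \<rho> \<one> u"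
    using rep_mult[OF one_closed one_closed assms] by simp
  then show ?thesis
    using tree_auts_inj[OF rep_aut[OF one_closed] rep_verts[OF one_closed assms] assms] by simp
qed

lemma rep_inv:
  assumes "g \<in> carrier G" "u \<in> tree_verts p"
  shows "\<rho> g (\<rho> (inv g) u) = u" "\<rho> (inv g) (\<rho> g u) = u"
  using assms rep_mult[of g "inv g" u] rep_mult[of "inv g" g u] rep_one by simp_all

lemma rep_Cons:
  "g \<in> carrier G \<Longrightarrow> i < p \<Longrightarrow> w \<in> tree_verts p \<Longrightarrow> \<rho> g (i # w) = perm g i # state p (\<rho> g) i w"
  using tree_aut_decomp[OF rep_aut] .

lemma perm_less:
  assumes "g \<in> carrier G" "i < p"
  shows "perm g i < p"
  using rep_verts[OF assms(1), of "[i]"] rep_Cons[OF assms, of "[]"] assms(2) by simp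

lemma perm_mult:
  assumes "g \<in> carrier G" "h \<in> carrier G" "i < p"
  shows "perm (g \<otimes> h) i = perm g (perm h i)"
proof -
  have v: "[i] \<in> tree_verts p" using assms(3) by simp
  have "state p (\<rho> h) i [] \<in> tree_verts p"
    using rep_verts[OF assms(2) v] rep_Cons[OF assms(2,3), of "[]"] by simp
  then have "hd (\<rho> g (\<rho> h [i])) = perm g (perm h i)"
    using rep_Cons[OF assms(2,3), of "[]"] rep_Cons[OF assms(1) perm_less[OF assms(2,3)]] by simp
  then show ?thesis
    unfolding level1_perm_def[of "\<rho> (g \<otimes> h)"] rep_mult[OF assms(1,2) v] .
qed

lemma perm_one: "i < p \<Longrightarrow> perm \<one> i = i"
  by (simp add: level1_perm_def rep_one)

lemma level1_action: 
  assumes "subgroup A G"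
  shows "group_action (G\<lparr>carrier := A\<rparr>) {..<p} (\<lambda>g. \<lambda>i \<in> {..<p}. perm g i)"
proof (intro group_action.intro group_hom.intro group_hom_axioms.intro homI)
  show "group (G\<lparr>carrier := A\<rparr>)" using assms by (rule subgroup_imp_group)
  show "group (BijGroup {..<p})" by (rule group_BijGroup)
  have bij: "(\<lambda>i \<in> {..<p}. perm g i) \<in> Bij {..<p}" if g: "g \<in> carrier G" for g
  proof -
    have "bij_betw (\<lambda>i \<in> {..<p}. perm g i) {..<p} {..<p}"
    proof (rule bij_betw_byWitness[where f' = "perm (inv g)"])
      show "\<forall>i \<in> {..<p}. perm (inv g) ((\<lambda>i \<in> {..<p}. perm g i) i) = i"
        using g perm_mult[of "inv g" g] perm_one by auto
      show "\<forall>i \<in> {..<p}. (\<lambda>i \<in> {..<p}. perm g i) (perm (inv g) i) = i"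
        using g perm_mult[of g "inv g"] perm_one perm_less[of "inv g"] by auto
      show "(\<lambda>i \<in> {..<p}. perm g i) ` {..<p} \<subseteq> {..<p}"
        using perm_less[OF g] by auto
      show "perm (inv g) ` {..<p} \<subseteq> {..<p}"
        using perm_less[OF inv_closed[OF g]] by auto
    qed
    then show ?thesis by (simp add: Bij_def)
  qed
  fix g assume "g \<in> carrier (G\<lparr>carrier := A\<rparr>)"
  then have g: "g \<in> carrier G" using subgroup.mem_carrier[OF assms] by simp
  then show "(\<lambda>i \<in> {..<p}. perm g i) \<in> carrier (BijGroup {..<p})"
    using bij by (simp add: BijGroup_def)
  fix h assume "h \<in> carrier (G\<lparr>carrier := A\<rparr>)"
  then have h: "h \<in> carrier G" using subgroup.mem_carrier[OF assms] by simp
  have "(\<lambda>i \<in> {..<p}. perm (g \<otimes> h) i) = compose {..<p} (\<lambda>i \<in> {..<p}. perm g i) (\<lambda>i \<in> {..<p}. perm h i)"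
    unfolding compose_def using perm_mult[OF g h] perm_less[OF h] by (intro restrict_ext) simp
  then show "(\<lambda>i \<in> {..<p}. perm (g \<otimes>\<^bsub>G\<lparr>carrier := A\<rparr>\<^esub> h) i) =
      (\<lambda>i \<in> {..<p}. perm g i) \<otimes>\<^bsub>BijGroup {..<p}\<^esub> (\<lambda>i \<in> {..<p}. perm h i)"
    using bij[OF g] bij[OF h] by (simp add: BijGroup_def)
qed

lemma stab_iff: "g \<in> stab \<longleftrightarrow> g \<in> carrier G \<and> (\<forall>i < p. perm g i = i)"
  by (simp add: first_level_stabilizer_def)

lemma subgroup_stab: "subgroup stab G"
proof (rule subgroupI)
  show "stab \<subseteq> carrier G" by (auto simp: stab_iff)
  have "\<one> \<in> stab" by (simp add: stab_iff perm_one)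
  then show "stab \<noteq> {}" by blast
  fix g assume g: "g \<in> stab"
  then have gG: "g \<in> carrier G" by (simp add: stab_iff)
  have "perm (inv g) i = i" if "i < p" for i
    using perm_mult[of "inv g" g i] g gG that by (simp add: stab_iff perm_one)
  then show "inv g \<in> stab" using gG by (simp add: stab_iff)
  fix h assume "h \<in> stab"
  then show "g \<otimes> h \<in> stab" using g by (simp add: stab_iff perm_mult)
qed

lemma normal_stab: "stab \<lhd> G"
  unfolding normal_inv_iff
proof (intro conjI ballI subgroup_stab)
  fix g h assume g: "g \<in> carrier G" and h: "h \<in> stab"
  have hG: "h \<in> carrier G" using h by (simp add: stab_iff)
  have "perm (g \<otimes> h \<otimes> inv g) i = i" if i: "i < p" for i
  proof -
    have "perm (g \<otimes> h \<otimes> inv g) i = perm g (perm h (perm (inv g) i))"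
      using g hG i perm_less[of "inv g" i] by (simp add: perm_mult)
    also have "\<dots> = perm g (perm (inv g) i)"
      using h g i perm_less[of "inv g" i] by (simp add: stab_iff)
    also have "\<dots> = i"
      using g i perm_mult[of g "inv g" i] by (simp add: perm_one)
    finally show ?thesis .
  qed
  then show "g \<otimes> h \<otimes> inv g \<in> stab"
    using g hG by (simp add: stab_iff)
qed

text \<open>The stabilizer of \<open>0\<close> is a \<open>p\<close>-group that acts on \<open>p\<close> points, so the number of its fixed
  points is a positive multiple of \<open>p\<close>.\<close>

lemma vertex_stabilizer_eq_stab:
  "{g \<in> carrier G. perm g 0 = 0} = stab" (is "?S = _")
proof
  show "stab \<subseteq> ?S" using p_pos by (auto simp: stab_iff)
  have S: "subgroup ?S G"
  proof (rule subgroupI)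
    have "\<one> \<in> ?S" using perm_one p_pos by simp
    then show "?S \<noteq> {}" by blast
    fix g assume g: "g \<in> ?S"
    then show "inv g \<in> ?S"
      using perm_mult[of "inv g" g 0] p_pos by (simp add: perm_one)
    fix h assume "h \<in> ?S"
    then show "g \<otimes> h \<in> ?S" using g p_pos by (simp add: perm_mult)
  qed blast
  interpret act: group_action "G\<lparr>carrier := ?S\<rparr>" "{..<p}" "\<lambda>g. \<lambda>i \<in> {..<p}. perm g i"
    using S by (rule level1_action)
  let ?F = "{i \<in> {..<p}. \<forall>g \<in> carrier (G\<lparr>carrier := ?S\<rparr>). (\<lambda>i \<in> {..<p}. perm g i) i = i}"
  have "card ?S dvd p ^ n"
    using card_subgroup_dvd[OF S subgroup_self subgroup.subset[OF S]] order_G by (simp add: order_def)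
  then obtain i where "card ?S = p ^ i"
    using divides_primepow_nat[OF prime_p] by auto
  then have "order (G\<lparr>carrier := ?S\<rparr>) = p ^ i" by (simp add: order_def)
  then have dvd: "p dvd card ?F"
    by (rule act.prime_power_dvd_card_fixed_points[OF prime_p]) simp_all
  have "0 \<in> ?F" using p_pos by simp
  then have "card ?F > 0" by (auto simp: card_gt_0_iff)
  then have "card {..<p} \<le> card ?F"
    using dvd_imp_le[OF dvd] by simp
  then have F: "?F = {..<p}"
    by (intro card_seteq) auto
  show "?S \<subseteq> stab"
  proof
    fix g assume g: "g \<in> ?S"
    have "perm g i = i" if "i < p" for i
    proof -
      have "i \<in> ?F" unfolding F using that by simp
      then show ?thesis using g that by simp
    qed
    then show "g \<in> stab" using g by (simp add: stab_iff)
  qed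
qed

lemma index_stab: "card (carrier G) = p * card stab"
proof -
  interpret act: group_action "G\<lparr>carrier := carrier G\<rparr>" "{..<p}" "\<lambda>g. \<lambda>i \<in> {..<p}. perm g i"
    using subgroup_self by (rule level1_action)
  have "orbit (G\<lparr>carrier := carrier G\<rparr>) (\<lambda>g. \<lambda>i \<in> {..<p}. perm g i) 0 = {..<p}"
  proof
    show "orbit (G\<lparr>carrier := carrier G\<rparr>) (\<lambda>g. \<lambda>i \<in> {..<p}. perm g i) 0 \<subseteq> {..<p}"
      unfolding orbit_def using perm_less p_pos by auto
    show "{..<p} \<subseteq> orbit (G\<lparr>carrier := carrier G\<rparr>) (\<lambda>g. \<lambda>i \<in> {..<p}. perm g i) 0"
    proof
      fix i assume "i \<in> {..<p}"
      then obtain g where "g \<in> carrier G" "perm g 0 = i"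
        using rep_transitive p_pos unfolding level1_transitive_def by blast
      then show "i \<in> orbit (G\<lparr>carrier := carrier G\<rparr>) (\<lambda>g. \<lambda>i \<in> {..<p}. perm g i) 0"
        unfolding orbit_def using p_pos by force
    qed
  qed
  moreover have "stabilizer (G\<lparr>carrier := carrier G\<rparr>) (\<lambda>g. \<lambda>i \<in> {..<p}. perm g i) 0 = stab"
    unfolding stabilizer_def vertex_stabilizer_eq_stab[symmetric] using p_pos by auto
  ultimately show ?thesis
    using act.orbit_stabilizer_theorem[of 0] p_pos by (simp add: order_def)
qed

definition state0 :: "'a \<Rightarrow> 'a" where
  "state0 g = inv_into (carrier G) \<rho> (state p (\<rho> g) 0)"

lemma
  assumes "g \<in> carrier G"
  shows state0_closed: "state0 g \<in> carrier G" and rep_state0: "\<rho> (state0 g) = state p (\<rho> g) 0"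
proof -
  have "state p (\<rho> g) 0 \<in> \<rho> ` carrier G"
    using rep_state_closed assms p_pos unfolding state_closed_def by blast
  then show "state0 g \<in> carrier G" "\<rho> (state0 g) = state p (\<rho> g) 0"
    unfolding state0_def by (rule inv_into_into, rule f_inv_into_f)
qed

lemma stab_carrier: "g \<in> stab \<Longrightarrow> g \<in> carrier G"
  by (simp add: stab_iff)

lemma rep_stab_Cons:
  assumes "g \<in> stab" "w \<in> tree_verts p"
  shows "\<rho> g (0 # w) = 0 # \<rho> (state0 g) w"
  using rep_Cons[of g 0 w] assms p_pos stab_carrier[OF assms(1)] by (simp add: rep_state0 stab_iff)

lemma rep_eqI:
  assumes "g \<in> carrier G" "h \<in> carrier G" "\<And>w. w \<in> tree_verts p \<Longrightarrow> \<rho> g w = \<rho> h w"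
  shows "g = h"
proof (rule inj_onD[OF rep_inj _ assms(1,2)])
  show "\<rho> g = \<rho> h"
    using rep_extensional[OF assms(1)] rep_extensional[OF assms(2)] assms(3) by (rule extensionalityI)
qed

lemma state0_mult:
  assumes "g \<in> stab" "h \<in> stab"
  shows "state0 (g \<otimes> h) = state0 g \<otimes> state0 h"
proof (rule rep_eqI)
  have mem: "g \<in> carrier G" "h \<in> carrier G" using assms by (simp_all add: stab_iff)
  have gh: "g \<otimes> h \<in> stab" using assms by (rule subgroup.m_closed[OF subgroup_stab])
  show "state0 (g \<otimes> h) \<in> carrier G" "state0 g \<otimes> state0 h \<in> carrier G"
    using mem by (simp_all add: state0_closed)
  fix w assume w: "w \<in> tree_verts p"
  have "0 # \<rho> (state0 (g \<otimes> h)) w = \<rho> g (\<rho> h (0 # w))"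
    using rep_stab_Cons[OF gh w] rep_mult[OF mem, of "0 # w"] w p_pos by simp
  also have "\<dots> = 0 # \<rho> (state0 g) (\<rho> (state0 h) w)"
    using rep_stab_Cons[OF assms(2) w] rep_stab_Cons[OF assms(1) rep_verts[OF state0_closed[OF mem(2)] w]] by simp
  also have "\<dots> = 0 # \<rho> (state0 g \<otimes> state0 h) w"
    using rep_mult[OF state0_closed[OF mem(1)] state0_closed[OF mem(2)] w] by simp
  finally show "\<rho> (state0 (g \<otimes> h)) w = \<rho> (state0 g \<otimes> state0 h) w" by simp
qed

text \<open>A word with first letter \<open>i\<close> is moved by some \<open>g\<close> from a word with first letter \<open>0\<close>. The conjugate
  of \<open>k\<close> by \<open>g\<close> again lies in \<open>K\<close>, and on words with first letter \<open>0\<close> it acts through its section,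
  which lies in \<open>K\<close>; so induction on the length of the word shows that \<open>K\<close> acts trivially.\<close>

lemma state0_simple:
  assumes K: "K \<lhd> G" "K \<subseteq> stab" "state0 ` K \<subseteq> K"
  shows "K = {\<one>}"
proof -
  have KG: "k \<in> carrier G" if "k \<in> K" for k
    using K(2) that by (auto simp: stab_iff)
  have fixed: "\<rho> k w = w" if "w \<in> tree_verts p" "k \<in> K" for k w
    using that
  proof (induction "length w" arbitrary: k w)
    case 0
    then show ?case
      using tree_auts_length[OF rep_aut[OF KG], of k w] by simp
  next
    case (Suc l)
    then obtain i v where w: "w = i # v" by (cases w) auto
    then have iv: "i < p" "v \<in> tree_verts p" "length v = l"
      using Suc.hyps(2) Suc.prems(1) by simp_all
    obtain g where g: "g \<in> carrier G" "perm g 0 = i"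
      using rep_transitive p_pos iv(1) unfolding level1_transitive_def by blast
    define u where "u = \<rho> (inv g) w"
    have gu: "\<rho> g u = w"
      unfolding u_def using g(1) Suc.prems(1) by (rule rep_inv(1))
    have "perm (inv g) i = 0"
      using perm_mult[OF inv_closed[OF g(1)] g(1) p_pos] g by (simp add: perm_one p_pos)
    then have u0: "u = 0 # state p (\<rho> (inv g)) i v"
      unfolding u_def w using rep_Cons[OF inv_closed[OF g(1)] iv(1,2)] by simp
    define v' where "v' = state p (\<rho> (inv g)) i v"
    have uv: "u \<in> tree_verts p" "length u = length w"
      unfolding u_def using rep_verts[OF inv_closed[OF g(1)] Suc.prems(1)]
        tree_auts_length[OF rep_aut[OF inv_closed[OF g(1)]] Suc.prems(1)] by simp_all
    then have v': "v' \<in> tree_verts p" "length v' = l"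
      using u0 w iv(3) unfolding v'_def by simp_all
    define k' where "k' = inv g \<otimes> k \<otimes> g"
    have k': "k' \<in> K"
      unfolding k'_def using normal.inv_op_closed1[OF K(1) g(1) Suc.prems(2)] .
    have "\<rho> k' u = 0 # \<rho> (state0 k') v'"
      using rep_stab_Cons[of k' v'] k' K(2) v'(1) u0 unfolding v'_def by blast
    also have "\<rho> (state0 k') v' = v'"
      using Suc.hyps(1)[of v' "state0 k'"] v' k' K(3) by blast
    finally have k'u: "\<rho> k' u = u"
      unfolding v'_def u0 .
    have "k \<otimes> g = g \<otimes> k'"
      unfolding k'_def using g(1) KG[OF Suc.prems(2)] by (simp add: m_assoc[symmetric])
    then have "\<rho> k (\<rho> g u) = \<rho> g (\<rho> k' u)"
      using rep_mult[OF KG[OF Suc.prems(2)] g(1) uv(1)] rep_mult[OF g(1) KG[OF k'] uv(1)] by simp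
    then show ?case
      unfolding k'u gu .
  qed
  have "k = \<one>" if "k \<in> K" for k
    using KG[OF that] one_closed by (rule rep_eqI) (simp add: fixed that rep_one)
  then show ?thesis
    using subgroup.one_closed[OF normal_imp_subgroup[OF K(1)]] by blast
qed

sublocale virtual: simple_virtual_endomorphism G p n stab state0
proof (intro simple_virtual_endomorphism.intro simple_virtual_endomorphism_axioms.intro is_group)
  show "Factorial_Ring.prime p" by (rule prime_p)
  show "finite (carrier G)" by (rule finite_G)
  show "order G = p ^ n" by (rule order_G)
  show "stab \<lhd> G" by (rule normal_stab)
  show "card (carrier G) = p * card stab" by (rule index_stab)
  show "\<And>h. h \<in> stab \<Longrightarrow> state0 h \<in> carrier G" by (simp add: state0_closed stab_iff)
  show "\<And>h k. h \<in> stab \<Longrightarrow> k \<in> stab \<Longrightarrow> state0 (h \<otimes> k) = state0 h \<otimes> state0 k" by (rule state0_mult)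
  show "\<And>K. K \<lhd> G \<Longrightarrow> K \<subseteq> stab \<Longrightarrow> state0 ` K \<subseteq> K \<Longrightarrow> K = {\<one>}" by (rule state0_simple)
qed

end

section \<open>The splitting theorem\<close>

theorem theorem1p2:
  fixes G :: "('a, 'b) monoid_scheme" and p :: nat
    and \<rho> :: "'a \<Rightarrow> nat list \<Rightarrow> nat list"
  assumes "Factorial_Ring.prime p"
    and "finite_p_group p G"
    and "self_similar_rep G p \<rho>"
    and "power_abelian p (G\<lparr>carrier := first_level_stabilizer G p \<rho>\<rparr>)"
  shows "\<exists>N C. internal_semidirect G N C \<and>
           p_group_of_exponent_p p (G\<lparr>carrier := N\<rparr>) \<and>
           cyclic_group (G\<lparr>carrier := C\<rparr>) \<and> order (G\<lparr>carrier := C\<rparr>) = p"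
proof -
  obtain n where n: "order G = p ^ n" and group: "group G" and fin: "finite (carrier G)"
    using assms(2) unfolding finite_p_group_def by blast
  interpret S: self_similar_p_group G p n \<rho>
    using assms(1,3) n group fin by (intro self_similar_p_group.intro self_similar_p_group_axioms.intro)
  define H where "H = first_level_stabilizer G p \<rho>"
  have H: "subgroup H G" unfolding H_def by (rule S.subgroup_stab)
  have pow: "x [^]\<^bsub>G\<lparr>carrier := H\<rparr>\<^esub> k = x [^]\<^bsub>G\<^esub> k" for x and k :: nat
    by (rule S.nat_pow_consistent[symmetric])
  have PA: "finite_p_group p (G\<lparr>carrier := H\<rparr>)"
    "Omega p 1 (G\<lparr>carrier := H\<rparr>) = {x \<in> H. x [^]\<^bsub>G\<^esub> p = \<one>\<^bsub>G\<^esub>}"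
    using assms(4) unfolding power_abelian_def H_def[symmetric] pow by simp_all
  have count: "card (power_subgroup p 1 (G\<lparr>carrier := H\<rparr>)) =
      card (rcosets\<^bsub>G\<lparr>carrier := H\<rparr>\<^esub> Omega p 1 (G\<lparr>carrier := H\<rparr>))"
    using assms(4) order_refl[of "1::nat"] unfolding power_abelian_def H_def[symmetric] by blast
  have "Omega p 1 (G\<lparr>carrier := H\<rparr>) = generate G {x \<in> H. x [^]\<^bsub>G\<^esub> p = \<one>\<^bsub>G\<^esub>}"
    unfolding Omega_def pow using S.generate_consistent[OF _ H] by simp
  moreover have "subgroup (generate G {x \<in> H. x [^]\<^bsub>G\<^esub> p = \<one>\<^bsub>G\<^esub>}) G"
    using subgroup.subset[OF H] by (intro S.generate_is_subgroup) blast
  ultimately have torsion: "subgroup {x \<in> H. x [^]\<^bsub>G\<^esub> p = \<one>\<^bsub>G\<^esub>} G"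
    unfolding PA(2) by simp
  interpret V: torsion_virtual_endomorphism G p n H S.state0
    using S.virtual.simple_virtual_endomorphism_axioms torsion unfolding H_def
    by (intro torsion_virtual_endomorphism.intro torsion_virtual_endomorphism_axioms.intro)
  have "{x [^]\<^bsub>G\<^esub> p | x. x \<in> H} \<subseteq> H"
    using S.subgroup_pow_closed[OF H] by blast
  from S.generate_consistent[OF this H]
  have "power_subgroup p 1 (G\<lparr>carrier := H\<rparr>) = generate G {x [^]\<^bsub>G\<^esub> p | x. x \<in> H}"
    unfolding power_subgroup_def pow by simp
  also have "{x [^]\<^bsub>G\<^esub> p | x. x \<in> H} = (\<lambda>x. x [^]\<^bsub>G\<^esub> p) ` H" by blast
  finally have "power_subgroup p 1 (G\<lparr>carrier := H\<rparr>) = V.power_span H"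
    unfolding V.power_span_def .
  then have H_eq: "H = V.torsion"
    using count unfolding PA(2) V.torsion_def[symmetric] by (intro V.H_eq_torsion) simp
  have "internal_semidirect G H V.C"
    unfolding internal_semidirect_def
  proof (intro conjI)
    show "H \<lhd> G" by (rule V.normal_H)
    show "subgroup V.C G" by (rule V.subgroup_C)
    show "H \<inter> V.C = {\<one>\<^bsub>G\<^esub>}" using V.C_Int_H by blast
    show "H <#>\<^bsub>G\<^esub> V.C = carrier G"
    proof
      show "H <#>\<^bsub>G\<^esub> V.C \<subseteq> carrier G"
        unfolding set_mult_def by auto
      show "carrier G \<subseteq> H <#>\<^bsub>G\<^esub> V.C"
      proof
        fix g assume "g \<in> carrier G"
        then obtain h b where "h \<in> H" "b \<in> V.C" "g = h \<otimes>\<^bsub>G\<^esub> b" by (rule V.H_mult_C)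
        then show "g \<in> H <#>\<^bsub>G\<^esub> V.C" unfolding set_mult_def by blast
      qed
    qed
  qed
  moreover have "p_group_of_exponent_p p (G\<lparr>carrier := H\<rparr>)"
    unfolding p_group_of_exponent_p_def pow
  proof (intro conjI ballI)
    show "finite_p_group p (G\<lparr>carrier := H\<rparr>)" by (rule PA(1))
    fix x assume "x \<in> carrier (G\<lparr>carrier := H\<rparr>)"
    then have "x \<in> V.torsion" using H_eq by simp
    then show "x [^]\<^bsub>G\<^esub> p = \<one>\<^bsub>G\<lparr>carrier := H\<rparr>\<^esub>" using V.torsion_pow by simp
  qed
  moreover have "order (G\<lparr>carrier := V.C\<rparr>) = p"
    using V.card_C by (simp add: order_def)
  ultimately show ?thesis
    using V.cyclic_C by blast
qed

end
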